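(* Let $G=(V,E,\omega)$ be a connected finite weighted graph, $\mathbb V=(\mathbb V_j)_{j=1}^n$ a real vector, $\mathbb W=(\mathbb W_{jl})_{1\le j,l\le n}$ a real symmetric matrix, $h>0$, and $\rho^0,\rho^1\in\mathcal P_o(G)$. Assume there exists a critical point $(v(t),\rho(t))$, $t\in[0,1]$ (in the sense defined in the context), of the functional $$\mathcal J(v)=\int_0^1\Big[\tfrac12 (v,v)_\rho-\tfrac{h^2}{8}\mathcal I(\rho)-\mathcal V(\rho)-\mathcal W(\rho)\Big]dt,$$ where $\rho(t)\in\mathcal P_o(G)$ satisfies $\frac{d\rho}{dt}+\mathrm{div}_G(\rho v)=0$, $\rho(0)=\rho^0$, $\rho(1)=\rho^1$, and assume $v(t)$ and $\rho(t)$ are smooth functions of $t$. Then: (a) $v(t)$ is a potential vector field: there exists a function $S(t)=(S_j(t))_{j=1}^n$ on the nodes such that $v_{jl}(t)=\sqrt{\omega_{jl}}\,(S_j(t)-S_l(t))$ for all $t\in[0,1]$ and all $(j,l)\in E$. (b) For every $S(t)$ that induces $v(t)$ as in (a), there exists a scalar function $C(t)\in\mathbb R$, independent of the nodes, such that $\rho(t)$ and $\bar S(t)=(S_j(t)-C(t))_{j=1}^n$ satisfy, for every $j\in V$, $$\frac{d\rho_j}{dt}+\sum_{l\in N(j)}\omega_{jl}(\bar S_l-\bar S_j)g_{jl}(\rho)=0,$$ $$\frac{d\bar S_j}{dt}+\frac12\sum_{l\in N(j)}\omega_{jl}(\bar S_j-\bar S_l)^2\frac{\partial g_{jl}}{\partial\rho_j}+\frac{h^2}{8}\frac{\partial}{\partial\rho_j}\mathcal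 I(\rho)+\mathbb V_j+\sum_{l=1}^n\mathbb W_{jl}\rho_l=0.$$
   Context: Graph: $G=(V,E,\omega)$ has vertex set $V=\{1,\dots,n\}$, is undirected, connected, without self-loops or multiple edges; $E$ is regarded as a set of ordered pairs containing both $(j,l)$ and $(l,j)$ for each edge; weights satisfy $\omega_{jl}=\omega_{lj}>0$ for $(j,l)\in E$. $N(j)=\{l\in V:(j,l)\in E\}$. $\mathcal P(G)=\{\rho\in\mathbb R^n:\sum_j\rho_j=1,\ \rho_j\ge0\}$ and $\mathcal P_o(G)$ is its interior (all $\rho_j>0$). $g_{jl}(\rho)=\frac{\rho_j+\rho_l}{2}$ for $(j,l)\in E$ (so $\partial g_{jl}/\partial\rho_j=\frac12$). A vector field on $G$ is $v=(v_{jl})_{(j,l)\in E}$ with $v_{lj}=-v_{jl}$. Divergence: $\mathrm{div}_G(\rho v)=-\big(\sum_{l\in N(j)}\sqrt{\omega_{jl}}\,v_{jl}\,g_{jl}(\rho)\big)_{j=1}^n$. Inner product: $(v,u)_\rho=\frac12\sum_{(j,l)\in E}v_{jl}u_{jl}g_{jl}(\rho)$. Discrete Fisher information: $\mathcal I(\rho)=\frac12\sum_{(j,l)\in E}\omega_{jl}(\log\rho_j-\log\rho_l)^2g_{jl}(\rho)$ for $\rho\in\mathcal P_o(G)$; partial derivatives with respect to $\rho_j$ are taken treating it as a function on $(0,\infty)^n$. $\mathcal V(\rho)=\sum_j\mathbb V_j\rho_j$, $\mathcal W(\rho)=\frac12\sum_{j,l}\mathbb W_{jl}\rho_j\rho_l$.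 Critical point: given a time-dependent vector field $v$ whose path $\rho$ (solving $\dot\rho+\mathrm{div}_G(\rho v)=0$, $\rho(0)=\rho^0$) stays in $\mathcal P_o(G)$ and satisfies $\rho(1)=\rho^1$, let $\mathcal D$ be the set of time-dependent vector fields $\delta v\in C^\infty[0,1]$ for which there is a continuously differentiable $\bar\rho:[0,1]\to\mathcal P_o(G)$ with $\dot{\bar\rho}+\mathrm{div}_G(\bar\rho(v+\delta v))=0$, $\bar\rho(0)=\rho^0$, $\bar\rho(1)=\rho^1$. The value $\mathcal J(v+\delta v)$ is computed with the vector field $v+\delta v$ and path $\bar\rho$. The pair $(v,\rho)$ is a critical point if $\mathcal J(v+\delta v)-\mathcal J(v)=o(\delta v)$ for $\delta v\in\mathcal D$, i.e. the difference is $o(\|\delta v\|_\infty)$ as $\delta v\to0$ within $\mathcal D$, where $\|\delta v\|_\infty=\sup_{t\in[0,1]}\max_{(j,l)\in E}|\delta v_{jl}(t)|$. *)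

theory Defs
  imports "HOL-Analysis.Analysis"
begin

text \<open>The vertex set is the finite type \<open>'n\<close>; an undirected edge is the two
  ordered pairs in \<open>E\<close>. Edge-indexed quantities are functions \<open>'n \<Rightarrow> 'n \<Rightarrow> real\<close>,
  whose values off \<open>E\<close> never enter any definition below.\<close>

definition connected_weighted_graph ::
    "('n::finite \<times> 'n) set \<Rightarrow> ('n \<Rightarrow> 'n \<Rightarrow> real) \<Rightarrow> bool" where
  "connected_weighted_graph E \<omega> \<longleftrightarrow>
     sym E \<and> irrefl E \<and> (\<forall>j l. (j, l) \<in> E\<^sup>*) \<and>
     (\<forall>(j, l)\<in>E. \<omega> j l = \<omega> l j \<and> \<omega> j l > 0)"

definition neighbours :: "('n \<times> 'n) set \<Rightarrow> 'n \<Rightarrow> 'n set" where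
  "neighbours E j = {l. (j, l) \<in> E}"

definition densities :: "(real ^ 'n::finite) set" where
  "densities = {\<rho>. (\<Sum>j\<in>UNIV. \<rho> $ j) = 1 \<and> (\<forall>j. \<rho> $ j \<ge> 0)}"

definition pos_densities :: "(real ^ 'n::finite) set" where
  "pos_densities = {\<rho> \<in> densities. \<forall>j. \<rho> $ j > 0}"

definition edge_mean :: "'n \<Rightarrow> 'n \<Rightarrow> real ^ 'n::finite \<Rightarrow> real" where
  "edge_mean j l \<rho> = (\<rho> $ j + \<rho> $ l) / 2"

definition vector_field :: "('n \<times> 'n) set \<Rightarrow> ('n \<Rightarrow> 'n \<Rightarrow> real) \<Rightarrow> bool" where
  "vector_field E u \<longleftrightarrow> (\<forall>(j, l)\<in>E. u l j = - u j l)"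

definition graph_div ::
    "('n::finite \<times> 'n) set \<Rightarrow> ('n \<Rightarrow> 'n \<Rightarrow> real) \<Rightarrow> real ^ 'n \<Rightarrow> ('n \<Rightarrow> 'n \<Rightarrow> real) \<Rightarrow> real ^ 'n" where
  "graph_div E \<omega> \<rho> u =
     - (\<chi> j. \<Sum>l\<in>neighbours E j. sqrt (\<omega> j l) * u j l * edge_mean j l \<rho>)"

definition field_inner ::
    "('n::finite \<times> 'n) set \<Rightarrow> real ^ 'n \<Rightarrow> ('n \<Rightarrow> 'n \<Rightarrow> real) \<Rightarrow> ('n \<Rightarrow> 'n \<Rightarrow> real) \<Rightarrow> real" where
  "field_inner E \<rho> u w = 1 / 2 * (\<Sum>(j, l)\<in>E. u j l * w j l * edge_mean j l \<rho>)"

definition fisher_info ::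
    "('n::finite \<times> 'n) set \<Rightarrow> ('n \<Rightarrow> 'n \<Rightarrow> real) \<Rightarrow> real ^ 'n \<Rightarrow> real" where
  "fisher_info E \<omega> \<rho> =
     1 / 2 * (\<Sum>(j, l)\<in>E. \<omega> j l * (ln (\<rho> $ j) - ln (\<rho> $ l))\<^sup>2 * edge_mean j l \<rho>)"

definition linear_potential :: "real ^ 'n::finite \<Rightarrow> real ^ 'n \<Rightarrow> real" where
  "linear_potential V \<rho> = (\<Sum>j\<in>UNIV. V $ j * \<rho> $ j)"

definition interaction_potential :: "real ^ 'n ^ 'n::finite \<Rightarrow> real ^ 'n \<Rightarrow> real" where
  "interaction_potential W \<rho> =
     1 / 2 * (\<Sum>j\<in>UNIV. \<Sum>l\<in>UNIV. W $ j $ l * \<rho> $ j * \<rho> $ l)"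

text \<open>Partial derivative on the ambient space (not along the simplex).\<close>

definition partial_deriv :: "'n \<Rightarrow> (real ^ 'n::finite \<Rightarrow> real) \<Rightarrow> real ^ 'n \<Rightarrow> real" where
  "partial_deriv j f \<rho> = deriv (\<lambda>s. f (\<rho> + s *\<^sub>R axis j 1)) 0"

text \<open>\<open>C\<^sup>\<infinity>[0,1]\<close>, with one-sided derivatives at the endpoints; \<open>F k\<close> is the
  \<open>k\<close>-th derivative. Only the values of \<open>f\<close> on \<open>[0,1]\<close> matter.\<close>

definition smooth_unit :: "(real \<Rightarrow> 'a::real_normed_vector) \<Rightarrow> bool" where
  "smooth_unit f \<longleftrightarrow> (\<exists>F. F 0 = f \<and>
     (\<forall>k::nat. \<forall>t\<in>{0..1}. (F k has_vector_derivative F (Suc k) t) (at t within {0..1})))"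

definition smooth_field :: "('n \<times> 'n) set \<Rightarrow> (real \<Rightarrow> 'n \<Rightarrow> 'n \<Rightarrow> real) \<Rightarrow> bool" where
  "smooth_field E v \<longleftrightarrow> (\<forall>(j, l)\<in>E. smooth_unit (\<lambda>t. v t j l))"

definition transports ::
    "('n::finite \<times> 'n) set \<Rightarrow> ('n \<Rightarrow> 'n \<Rightarrow> real) \<Rightarrow> real ^ 'n \<Rightarrow> real ^ 'n \<Rightarrow>
     (real \<Rightarrow> 'n \<Rightarrow> 'n \<Rightarrow> real) \<Rightarrow> (real \<Rightarrow> real ^ 'n) \<Rightarrow> bool" where
  "transports E \<omega> \<rho>0 \<rho>1 v \<rho> \<longleftrightarrow>
     (\<forall>t\<in>{0..1}. \<rho> t \<in> pos_densities) \<and>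
     (\<exists>\<rho>'. continuous_on {0..1} \<rho>' \<and>
        (\<forall>t\<in>{0..1}. (\<rho> has_vector_derivative \<rho>' t) (at t within {0..1}) \<and>
           \<rho>' t + graph_div E \<omega> (\<rho> t) (v t) = 0)) \<and>
     \<rho> 0 = \<rho>0 \<and> \<rho> 1 = \<rho>1"

definition action ::
    "('n::finite \<times> 'n) set \<Rightarrow> ('n \<Rightarrow> 'n \<Rightarrow> real) \<Rightarrow> real \<Rightarrow> real ^ 'n \<Rightarrow> real ^ 'n ^ 'n \<Rightarrow>
     (real \<Rightarrow> 'n \<Rightarrow> 'n \<Rightarrow> real) \<Rightarrow> (real \<Rightarrow> real ^ 'n) \<Rightarrow> real" where
  "action E \<omega> h V W v \<rho> = integral {0..1} (\<lambda>t.
     1 / 2 * field_inner E (\<rho> t) (v t) (v t) - h\<^sup>2 / 8 * fisher_info E \<omega> (\<rho> t)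
     - linear_potential V (\<rho> t) - interaction_potential W (\<rho> t))"

definition add_field ::
    "(real \<Rightarrow> 'n \<Rightarrow> 'n \<Rightarrow> real) \<Rightarrow> (real \<Rightarrow> 'n \<Rightarrow> 'n \<Rightarrow> real) \<Rightarrow> real \<Rightarrow> 'n \<Rightarrow> 'n \<Rightarrow> real" where
  "add_field v w t j l = v t j l + w t j l"

definition variations ::
    "('n::finite \<times> 'n) set \<Rightarrow> ('n \<Rightarrow> 'n \<Rightarrow> real) \<Rightarrow> real ^ 'n \<Rightarrow> real ^ 'n \<Rightarrow>
     (real \<Rightarrow> 'n \<Rightarrow> 'n \<Rightarrow> real) \<Rightarrow> (real \<Rightarrow> 'n \<Rightarrow> 'n \<Rightarrow> real) set" where
  "variations E \<omega> \<rho>0 \<rho>1 v =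
     {\<delta>v. (\<forall>t\<in>{0..1}. vector_field E (\<delta>v t)) \<and> smooth_field E \<delta>v \<and>
          (\<exists>\<sigma>. transports E \<omega> \<rho>0 \<rho>1 (add_field v \<delta>v) \<sigma>)}"

text \<open>Inserting 0 makes the maximum meaningful for the one-vertex graph, where \<open>E\<close> is empty.\<close>

definition field_norm :: "('n::finite \<times> 'n) set \<Rightarrow> (real \<Rightarrow> 'n \<Rightarrow> 'n \<Rightarrow> real) \<Rightarrow> real" where
  "field_norm E w = (SUP t\<in>{0..1}. Max (insert 0 ((\<lambda>(j, l). \<bar>w t j l\<bar>) ` E)))"

text \<open>For \<open>v\<close> continuous in time, the path \<open>\<sigma>\<close> of \<open>v + \<delta>v\<close> solves a linear initial value problem, so it is unique on
  \<open>[0,1]\<close> and \<open>action \<dots> (add_field v \<delta>v) \<sigma>\<close> depends on \<open>\<delta>v\<close> alone.\<close>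

definition critical_point ::
    "('n::finite \<times> 'n) set \<Rightarrow> ('n \<Rightarrow> 'n \<Rightarrow> real) \<Rightarrow> real \<Rightarrow> real ^ 'n \<Rightarrow> real ^ 'n ^ 'n \<Rightarrow>
     real ^ 'n \<Rightarrow> real ^ 'n \<Rightarrow> (real \<Rightarrow> 'n \<Rightarrow> 'n \<Rightarrow> real) \<Rightarrow> (real \<Rightarrow> real ^ 'n) \<Rightarrow> bool" where
  "critical_point E \<omega> h V W \<rho>0 \<rho>1 v \<rho> \<longleftrightarrow>
     (\<forall>t\<in>{0..1}. vector_field E (v t)) \<and>
     transports E \<omega> \<rho>0 \<rho>1 v \<rho> \<and>
     (\<forall>\<epsilon>>0. \<exists>\<eta>>0. \<forall>\<delta>v\<in>variations E \<omega> \<rho>0 \<rho>1 v. field_norm E \<delta>v < \<eta> \<longrightarrow>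
        (\<forall>\<sigma>. transports E \<omega> \<rho>0 \<rho>1 (add_field v \<delta>v) \<sigma> \<longrightarrow>
           \<bar>action E \<omega> h V W (add_field v \<delta>v) \<sigma> - action E \<omega> h V W v \<rho>\<bar>
             \<le> \<epsilon> * field_norm E \<delta>v))"

definition induces ::
    "('n \<times> 'n) set \<Rightarrow> ('n \<Rightarrow> 'n \<Rightarrow> real) \<Rightarrow>
     (real \<Rightarrow> real ^ 'n::finite) \<Rightarrow> (real \<Rightarrow> 'n \<Rightarrow> 'n \<Rightarrow> real) \<Rightarrow> bool" where
  "induces E \<omega> S v \<longleftrightarrow>
     (\<forall>t\<in>{0..1}. \<forall>(j, l)\<in>E. v t j l = sqrt (\<omega> j l) * (S t $ j - S t $ l))"

end

theory Submission
  imports Defs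
begin

text \<open>Vary the path and the flux \<open>m = v g(\<rho>)\<close> instead of the vector field: the continuity equation is
  linear in \<open>(\<rho>, m)\<close>, so \<open>(\<rho> + \<epsilon>a, m + \<epsilon>\<mu>)\<close> is admissible whenever \<open>a' = - div \<mu>\<close> and \<open>a\<close> vanishes at
  both ends, and \<open>\<delta>v = (m + \<epsilon>\<mu>) / g(\<rho> + \<epsilon>a) - v\<close> is smooth of size \<open>O(\<epsilon>)\<close>; no differential
  equation has to be solved to hit \<open>\<rho>\<^sup>1\<close>. Criticality gives
  \<open>\<integral> (1/2 \<Sum> v \<mu> - 1/4 \<Sum> v\<^sup>2 g(a) - dU(\<rho>) a) dt = 0\<close>. With \<open>a = 0\<close> and \<open>\<mu>\<close> divergence free, \<open>v\<close> is orthogonal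
  to all divergence-free fields, hence a gradient. Moving mass along a single edge
  gives the Hamilton-Jacobi equation differenced along that edge; by connectedness the
  residuals agree at all vertices, and their common value is absorbed into \<open>C\<close>.\<close>

section \<open>Smooth functions on the unit interval\<close>

text \<open>A derivative chosen inside \<open>P\<close> can be differentiated again, and iterating
  the choice yields the whole sequence of derivatives. The choice matters: on \<open>{0..1}\<close>
  the derivative is unique, but elsewhere its values are free, and \<open>P\<close> may hold for
  only some of the extensions.\<close>

lemma smooth_unit_coinduct:
  assumes "P f" and step: "\<And>g. P g \<Longrightarrow> \<exists>g'. P g' \<and>
    (\<forall>t\<in>{0..1}. (g has_vector_derivative g' t) (at t within {0..1}))"
  shows "smooth_unit f"
proof -
  define D where "D g = (SOME g'. P g' \<and>
    (\<forall>t\<in>{0..1}. (g has_vector_derivative g' t) (at t within {0..1})))" for g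
  have D: "P (D g) \<and> (\<forall>t\<in>{0..1}. (g has_vector_derivative D g t) (at t within {0..1}))"
    if "P g" for g
    using someI_ex[OF step[OF that]] unfolding D_def .
  have "P ((D ^^ k) f)" for k
    by (induction k) (use assms(1) D in auto)
  then show ?thesis
    unfolding smooth_unit_def using D by (intro exI[of _ "\<lambda>k. (D ^^ k) f"]) auto
qed

lemma smooth_unit_obtain_deriv:
  assumes "smooth_unit f"
  obtains f' where "smooth_unit f'"
    "\<And>t. t \<in> {0..1} \<Longrightarrow> (f has_vector_derivative f' t) (at t within {0..1})"
proof -
  from assms obtain F where F: "F 0 = f"
    "\<And>k t. t \<in> {0..1} \<Longrightarrow> (F k has_vector_derivative F (Suc k) t) (at t within {0..1})"
    unfolding smooth_unit_def by blast
  show ?thesis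
  proof (rule that)
    show "smooth_unit (F 1)"
      unfolding smooth_unit_def using F(2) by (intro exI[of _ "\<lambda>k. F (Suc k)"]) auto
    show "(f has_vector_derivative F 1 t) (at t within {0..1})" if "t \<in> {0..1}" for t
      using F(2)[OF that, of 0] F(1) by simp
  qed
qed

lemma smooth_unit_continuous: "smooth_unit f \<Longrightarrow> continuous_on {0..1} f"
  by (erule smooth_unit_obtain_deriv)
    (simp only: continuous_on_eq_continuous_within, blast intro: has_vector_derivative_continuous)

lemma smooth_unit_const: "smooth_unit (\<lambda>t. c)"
  by (rule smooth_unit_coinduct[where P = "\<lambda>h. \<exists>c. h = (\<lambda>t. c)"])
    (blast intro: has_vector_derivative_const)+

lemma smooth_unit_ident: "smooth_unit (\<lambda>t::real. t)"
proof (rule smooth_unit_coinduct[where P = "\<lambda>h. h = (\<lambda>t. t) \<or> smooth_unit h"])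
  fix g :: "real \<Rightarrow> real" assume "g = (\<lambda>t. t) \<or> smooth_unit g"
  then show "\<exists>g'. (g' = (\<lambda>t. t) \<or> smooth_unit g') \<and>
    (\<forall>t\<in>{0..1}. (g has_vector_derivative g' t) (at t within {0..1}))"
  proof
    assume g: "g = (\<lambda>t. t)"
    show ?thesis
      unfolding g by (rule exI[of _ "\<lambda>t. 1"]) (simp add: smooth_unit_const)
  next
    assume "smooth_unit g"
    then show ?thesis by (rule smooth_unit_obtain_deriv) blast
  qed
qed simp

lemma smooth_unit_vec_nth:
  assumes "smooth_unit f"
  shows "smooth_unit (\<lambda>t. f t $ j)"
proof -
  from assms obtain F where F: "F 0 = f"
    "\<And>k t. t \<in> {0..1} \<Longrightarrow> (F k has_vector_derivative F (Suc k) t) (at t within {0..1})"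
    unfolding smooth_unit_def by blast
  have "((\<lambda>t. F k t $ j) has_vector_derivative F (Suc k) t $ j) (at t within {0..1})"
    if "t \<in> {0..1}" for k t
    using bounded_linear.has_vector_derivative[OF bounded_linear_vec_nth F(2)[OF that]] .
  then show ?thesis
    unfolding smooth_unit_def using F(1) by (intro exI[of _ "\<lambda>k t. F k t $ j"]) auto
qed

text \<open>Closing the smooth functions under the operations below yields a class stable under
  differentiation; coinduction then shows that it contains only smooth functions.\<close>

inductive smooth_closure :: "(real \<Rightarrow> real) \<Rightarrow> bool" where
  base: "smooth_unit f \<Longrightarrow> smooth_closure f"
| add: "smooth_closure f \<Longrightarrow> smooth_closure g \<Longrightarrow> smooth_closure (\<lambda>t. f t + g t)"
| mult: "smooth_closure f \<Longrightarrow> smooth_closure g \<Longrightarrow> smooth_closure (\<lambda>t. f t * g t)"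
| inverse: "smooth_closure f \<Longrightarrow> (\<And>t. t \<in> {0..1} \<Longrightarrow> f t \<noteq> 0) \<Longrightarrow> smooth_closure (\<lambda>t. inverse (f t))"
| ln: "smooth_closure f \<Longrightarrow> (\<And>t. t \<in> {0..1} \<Longrightarrow> f t > 0) \<Longrightarrow> smooth_closure (\<lambda>t. ln (f t))"

lemma smooth_closure_deriv:
  assumes "smooth_closure f"
  shows "\<exists>f'. smooth_closure f' \<and>
    (\<forall>t\<in>{0..1}. (f has_vector_derivative f' t) (at t within {0..1}))"
  using assms
proof induction
  case (base f)
  then show ?case by (meson smooth_unit_obtain_deriv smooth_closure.base)
next
  case (add f g)
  then obtain f' g' where "smooth_closure f'" "smooth_closure g'"
    "\<And>t. t \<in> {0..1} \<Longrightarrow> (f has_vector_derivative f' t) (at t within {0..1})"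
    "\<And>t. t \<in> {0..1} \<Longrightarrow> (g has_vector_derivative g' t) (at t within {0..1})"
    by blast
  then show ?case
    by (intro exI[of _ "\<lambda>t. f' t + g' t"])
      (simp add: smooth_closure.add has_vector_derivative_add)
next
  case (mult f g)
  then obtain f' g' where "smooth_closure f'" "smooth_closure g'"
    "\<And>t. t \<in> {0..1} \<Longrightarrow> (f has_vector_derivative f' t) (at t within {0..1})"
    "\<And>t. t \<in> {0..1} \<Longrightarrow> (g has_vector_derivative g' t) (at t within {0..1})"
    by blast
  then show ?case using mult.hyps
    by (intro exI[of _ "\<lambda>t. f t * g' t + f' t * g t"])
      (simp add: smooth_closure.add smooth_closure.mult has_vector_derivative_mult)
next
  case (inverse f)
  then obtain f' where f': "smooth_closure f'"
    "\<And>t. t \<in> {0..1} \<Longrightarrow> (f has_real_derivative f' t) (at t within {0..1})"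
    by (auto simp: has_real_derivative_iff_has_vector_derivative)
  \<comment> \<open>Negation is not among the closure rules, so the sign enters as a factor that is
    a constant smooth function.\<close>
  show ?case
  proof (intro exI[of _ "\<lambda>t. (- 1) * (inverse (f t) * (f' t * inverse (f t)))"] conjI ballI)
    show "smooth_closure (\<lambda>t. (- 1) * (inverse (f t) * (f' t * inverse (f t))))"
      by (intro smooth_closure.mult smooth_closure.inverse smooth_closure.base[OF smooth_unit_const]
          inverse.hyps f'(1))
    show "((\<lambda>t. Fields.inverse (f t)) has_vector_derivative
        (- 1) * (Fields.inverse (f t) * (f' t * Fields.inverse (f t)))) (at t within {0..1})"
      if "t \<in> {0..1}" for t
      using DERIV_inverse'[OF f'(2)[OF that]] inverse(2)[OF that]
      by (simp add: has_real_derivative_iff_has_vector_derivative mult.assoc)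
  qed
next
  case (ln f)
  then obtain f' where f': "smooth_closure f'"
    "\<And>t. t \<in> {0..1} \<Longrightarrow> (f has_real_derivative f' t) (at t within {0..1})"
    by (auto simp: has_real_derivative_iff_has_vector_derivative)
  show ?case
  proof (intro exI[of _ "\<lambda>t. inverse (f t) * f' t"] conjI ballI)
    show "smooth_closure (\<lambda>t. inverse (f t) * f' t)"
      using ln.hyps(2) by (intro smooth_closure.mult smooth_closure.inverse ln.hyps(1) f'(1)) force
    show "((\<lambda>t. Transcendental.ln (f t)) has_vector_derivative inverse (f t) * f' t) (at t within {0..1})"
      if "t \<in> {0..1}" for t
      using DERIV_chain2[OF DERIV_ln[OF ln(2)[OF that]] f'(2)[OF that]]
      by (simp add: has_real_derivative_iff_has_vector_derivative)
  qed
qed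

lemma smooth_unit_closure: "smooth_closure f \<Longrightarrow> smooth_unit f"
  by (erule smooth_unit_coinduct[where P = smooth_closure]) (rule smooth_closure_deriv)

context
  fixes f g :: "real \<Rightarrow> real"
  assumes f: "smooth_unit f"
begin

lemma smooth_unit_add: "smooth_unit g \<Longrightarrow> smooth_unit (\<lambda>t. f t + g t)"
  by (rule smooth_unit_closure[OF smooth_closure.add[OF smooth_closure.base[OF f] smooth_closure.base]])

lemma smooth_unit_mult: "smooth_unit g \<Longrightarrow> smooth_unit (\<lambda>t. f t * g t)"
  by (rule smooth_unit_closure[OF smooth_closure.mult[OF smooth_closure.base[OF f] smooth_closure.base]])

lemma smooth_unit_inverse:
  "(\<And>t. t \<in> {0..1} \<Longrightarrow> f t \<noteq> 0) \<Longrightarrow> smooth_unit (\<lambda>t. inverse (f t))"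
  by (rule smooth_unit_closure[OF smooth_closure.inverse[OF smooth_closure.base[OF f]]])

lemma smooth_unit_ln:
  "(\<And>t. t \<in> {0..1} \<Longrightarrow> f t > 0) \<Longrightarrow> smooth_unit (\<lambda>t. ln (f t))"
  by (rule smooth_unit_closure[OF smooth_closure.ln[OF smooth_closure.base[OF f]]])

end

lemma smooth_unit_uminus:
  fixes f :: "real \<Rightarrow> real"
  assumes "smooth_unit f"
  shows "smooth_unit (\<lambda>t. - f t)"
  using smooth_unit_mult[OF smooth_unit_const[of "-1"] assms] by simp

lemma smooth_unit_diff:
  fixes f g :: "real \<Rightarrow> real"
  assumes "smooth_unit f" "smooth_unit g"
  shows "smooth_unit (\<lambda>t. f t - g t)"
  using smooth_unit_add[OF assms(1) smooth_unit_uminus[OF assms(2)]] by simp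

lemma smooth_unit_divide:
  fixes f g :: "real \<Rightarrow> real"
  shows "smooth_unit f \<Longrightarrow> smooth_unit g \<Longrightarrow> (\<And>t. t \<in> {0..1} \<Longrightarrow> g t \<noteq> 0) \<Longrightarrow>
    smooth_unit (\<lambda>t. f t / g t)"
  unfolding divide_inverse by (intro smooth_unit_mult smooth_unit_inverse)

lemma smooth_unit_power:
  fixes f :: "real \<Rightarrow> real" shows "smooth_unit f \<Longrightarrow> smooth_unit (\<lambda>t. f t ^ k)"
  by (induction k) (simp_all only: power_0 power_Suc smooth_unit_const smooth_unit_mult)

lemma smooth_unit_sum:
  fixes f :: "'i \<Rightarrow> real \<Rightarrow> real"
  assumes "finite I" "\<And>i. i \<in> I \<Longrightarrow> smooth_unit (f i)"
  shows "smooth_unit (\<lambda>t. \<Sum>i\<in>I. f i t)"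
  using assms
proof (induction I)
  case (insert i I)
  then have "smooth_unit (\<lambda>t. f i t + (\<Sum>i\<in>I. f i t))"
    by (intro smooth_unit_add) auto
  then show ?case using insert.hyps by simp
qed (simp add: smooth_unit_const)

section \<open>Energies and their directional derivatives\<close>

text \<open>The differential of \<open>fisher_info\<close> at \<open>\<rho>\<close> in the direction
  \<open>a\<close>. The direction need not be tangent to the simplex, so \<open>a = axis j 1\<close>
  gives the partial derivatives on the ambient space.\<close>

definition fisher_deriv ::
    "('n::finite \<times> 'n) set \<Rightarrow> ('n \<Rightarrow> 'n \<Rightarrow> real) \<Rightarrow> real ^ 'n \<Rightarrow> real ^ 'n \<Rightarrow> real" where
  "fisher_deriv E \<omega> \<rho> a = 1 / 2 * (\<Sum>(j, l)\<in>E. \<omega> j l *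
     (2 * (ln (\<rho> $ j) - ln (\<rho> $ l)) * (a $ j / \<rho> $ j - a $ l / \<rho> $ l) * edge_mean j l \<rho>
      + (ln (\<rho> $ j) - ln (\<rho> $ l))\<^sup>2 * edge_mean j l a))"

text \<open>The function U of the overview: the part of the integrand that sees only the density,
  with its sign reversed.\<close>

definition potential_energy ::
    "('n::finite \<times> 'n) set \<Rightarrow> ('n \<Rightarrow> 'n \<Rightarrow> real) \<Rightarrow> real \<Rightarrow> real ^ 'n \<Rightarrow> real ^ 'n ^ 'n \<Rightarrow> real ^ 'n \<Rightarrow> real" where
  "potential_energy E \<omega> h V W \<rho> =
     h\<^sup>2 / 8 * fisher_info E \<omega> \<rho> + linear_potential V \<rho> + interaction_potential W \<rho>"

definition energy_deriv ::
    "('n::finite \<times> 'n) set \<Rightarrow> ('n \<Rightarrow> 'n \<Rightarrow> real) \<Rightarrow> real \<Rightarrow> real ^ 'n \<Rightarrow> real ^ 'n ^ 'n \<Rightarrow> real ^ 'n \<Rightarrow> real ^ 'n \<Rightarrow> real" where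
  "energy_deriv E \<omega> h V W \<rho> a =
     h\<^sup>2 / 8 * fisher_deriv E \<omega> \<rho> a + (\<Sum>j\<in>UNIV. (V $ j + (\<Sum>l\<in>UNIV. W $ j $ l * \<rho> $ l)) * a $ j)"

text \<open>Kinetic energy in terms of the flux m = v g, using v^2 g = m^2 / g. The factor 1/4
  combines the 1/2 of \<open>action\<close> with the 1/2 of \<open>field_inner\<close>.\<close>

definition flux_energy :: "('n::finite \<times> 'n) set \<Rightarrow> ('n \<Rightarrow> 'n \<Rightarrow> real) \<Rightarrow> real ^ 'n \<Rightarrow> real" where
  "flux_energy E m \<rho> = 1 / 4 * (\<Sum>(j, l)\<in>E. (m j l)\<^sup>2 / edge_mean j l \<rho>)"

lemma edge_mean_linear:
  "edge_mean j l (\<rho> + \<sigma>) = edge_mean j l \<rho> + edge_mean j l \<sigma>"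
  "edge_mean j l (\<rho> - \<sigma>) = edge_mean j l \<rho> - edge_mean j l \<sigma>"
  "edge_mean j l (c *\<^sub>R \<rho>) = c * edge_mean j l \<rho>"
  by (simp_all add: edge_mean_def algebra_simps add_divide_distrib diff_divide_distrib)

lemma edge_mean_pos: "(\<And>j. \<rho> $ j > 0) \<Longrightarrow> edge_mean j l \<rho> > 0"
  by (simp add: edge_mean_def add_pos_pos)

text \<open>Stated at every parameter \<open>s\<close>, because differentiation under the integral
  sign requires the derivative on a whole interval of parameters.\<close>

lemma fisher_info_has_deriv:
  assumes pos: "\<And>j. (\<rho> + s *\<^sub>R a) $ j > 0"
  shows "((\<lambda>s. fisher_info E \<omega> (\<rho> + s *\<^sub>R a)) has_real_derivative
    fisher_deriv E \<omega> (\<rho> + s *\<^sub>R a) a) (at s within T)"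
proof -
  have pos': "\<rho> $ j + s * a $ j > 0" for j
    using pos[of j] by simp
  have "((\<lambda>s. \<omega> j l * (ln (\<rho> $ j + s * a $ j) - ln (\<rho> $ l + s * a $ l))\<^sup>2
        * (edge_mean j l \<rho> + s * edge_mean j l a)) has_real_derivative
      \<omega> j l * (2 * (ln (\<rho> $ j + s * a $ j) - ln (\<rho> $ l + s * a $ l))
        * (a $ j / (\<rho> $ j + s * a $ j) - a $ l / (\<rho> $ l + s * a $ l))
        * (edge_mean j l \<rho> + s * edge_mean j l a)
        + (ln (\<rho> $ j + s * a $ j) - ln (\<rho> $ l + s * a $ l))\<^sup>2 * edge_mean j l a)) (at s within T)" for j l
  proof -
    have L: "((\<lambda>s. ln (\<rho> $ j + s * a $ j) - ln (\<rho> $ l + s * a $ l)) has_real_derivative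
        a $ j / (\<rho> $ j + s * a $ j) - a $ l / (\<rho> $ l + s * a $ l)) (at s within T)"
      using pos'[of j] pos'[of l] by (auto intro!: derivative_eq_intros)
    have G: "((\<lambda>s. edge_mean j l \<rho> + s * edge_mean j l a) has_real_derivative edge_mean j l a) (at s within T)"
      by (auto intro!: derivative_eq_intros)
    show ?thesis
      by (rule DERIV_cong[OF DERIV_mult[OF DERIV_cmult[OF DERIV_power[OF L]] G]])
        (simp add: distrib_left mult_ac)
  qed
  then show ?thesis
    unfolding fisher_info_def fisher_deriv_def
    by (intro DERIV_cmult DERIV_sum) (auto simp: edge_mean_linear split_beta)
qed

text \<open>The product rule produces two double sums; symmetry of \<open>W\<close> and an exchange
  of summations identify them, which cancels the factor 1/2.\<close>

lemma interaction_potential_has_deriv: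
  assumes sym: "\<And>j l. W $ j $ l = W $ l $ j"
  shows "((\<lambda>s. interaction_potential W (\<rho> + s *\<^sub>R a)) has_real_derivative
    (\<Sum>j\<in>UNIV. (\<Sum>l\<in>UNIV. W $ j $ l * (\<rho> + s *\<^sub>R a) $ l) * a $ j)) (at s within T)"
proof -
  let ?\<sigma> = "\<rho> + s *\<^sub>R a"
  have "(\<Sum>j\<in>UNIV. \<Sum>l\<in>UNIV. W $ j $ l * ?\<sigma> $ j * a $ l) =
      (\<Sum>l\<in>UNIV. \<Sum>j\<in>UNIV. W $ j $ l * ?\<sigma> $ j * a $ l)"
    by (rule sum.swap)
  also have "\<dots> = (\<Sum>j\<in>UNIV. \<Sum>l\<in>UNIV. W $ j $ l * a $ j * ?\<sigma> $ l)"
    by (intro sum.cong refl) (simp add: sym mult_ac)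
  finally have swap: "(\<Sum>j\<in>UNIV. \<Sum>l\<in>UNIV. W $ j $ l * ?\<sigma> $ j * a $ l) =
      (\<Sum>j\<in>UNIV. \<Sum>l\<in>UNIV. W $ j $ l * a $ j * ?\<sigma> $ l)" .
  have "((\<lambda>s. W $ j $ l * (\<rho> + s *\<^sub>R a) $ j * (\<rho> + s *\<^sub>R a) $ l) has_real_derivative
      W $ j $ l * a $ j * ?\<sigma> $ l + W $ j $ l * ?\<sigma> $ j * a $ l) (at s within T)" for j l
    by (auto intro!: derivative_eq_intros simp: algebra_simps)
  then have "((\<lambda>s. interaction_potential W (\<rho> + s *\<^sub>R a)) has_real_derivative
      1 / 2 * (\<Sum>j\<in>UNIV. \<Sum>l\<in>UNIV. W $ j $ l * a $ j * ?\<sigma> $ l + W $ j $ l * ?\<sigma> $ j * a $ l)) (at s within T)"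
    unfolding interaction_potential_def by (intro DERIV_cmult DERIV_sum)
  also have "1 / 2 * (\<Sum>j\<in>UNIV. \<Sum>l\<in>UNIV. W $ j $ l * a $ j * ?\<sigma> $ l + W $ j $ l * ?\<sigma> $ j * a $ l)
      = (\<Sum>j\<in>UNIV. \<Sum>l\<in>UNIV. W $ j $ l * a $ j * ?\<sigma> $ l)"
    unfolding sum.distrib swap by simp
  also have "\<dots> = (\<Sum>j\<in>UNIV. (\<Sum>l\<in>UNIV. W $ j $ l * ?\<sigma> $ l) * a $ j)"
    unfolding sum_distrib_right by (intro sum.cong refl) (simp add: mult_ac)
  finally show ?thesis .
qed

lemma potential_energy_has_deriv:
  assumes "\<And>j l. W $ j $ l = W $ l $ j" "\<And>j. (\<rho> + s *\<^sub>R a) $ j > 0"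
  shows "((\<lambda>s. potential_energy E \<omega> h V W (\<rho> + s *\<^sub>R a)) has_real_derivative
    energy_deriv E \<omega> h V W (\<rho> + s *\<^sub>R a) a) (at s within T)"
proof -
  have *: "((\<lambda>s. linear_potential V (\<rho> + s *\<^sub>R a)) has_real_derivative
      (\<Sum>j\<in>UNIV. V $ j * a $ j)) (at s within T)"
    unfolding linear_potential_def
    by (intro DERIV_sum) (auto intro!: derivative_eq_intros)
  have "((\<lambda>s. potential_energy E \<omega> h V W (\<rho> + s *\<^sub>R a)) has_real_derivative
      h\<^sup>2 / 8 * fisher_deriv E \<omega> (\<rho> + s *\<^sub>R a) a + (\<Sum>j\<in>UNIV. V $ j * a $ j) +
      (\<Sum>j\<in>UNIV. (\<Sum>l\<in>UNIV. W $ j $ l * (\<rho> + s *\<^sub>R a) $ l) * a $ j)) (at s within T)"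
    unfolding potential_energy_def
    by (intro DERIV_add DERIV_cmult fisher_info_has_deriv[OF assms(2)] *
        interaction_potential_has_deriv[OF assms(1)])
  then show ?thesis
    by (simp only: energy_deriv_def distrib_right sum.distrib add.assoc)
qed

text \<open>The quotient rule for m^2 / g is arranged in powers of m / g, because this quotient is
  the velocity.\<close>

lemma flux_energy_has_deriv:
  assumes pos: "\<And>j. (\<rho> + s *\<^sub>R a) $ j > 0"
  shows "((\<lambda>s. flux_energy E (\<lambda>j l. m j l + s * \<mu> j l) (\<rho> + s *\<^sub>R a)) has_real_derivative
    1 / 4 * (\<Sum>(j, l)\<in>E. 2 * ((m j l + s * \<mu> j l) / edge_mean j l (\<rho> + s *\<^sub>R a)) * \<mu> j l
      - ((m j l + s * \<mu> j l) / edge_mean j l (\<rho> + s *\<^sub>R a))\<^sup>2 * edge_mean j l a)) (at s within T)"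
proof -
  have "((\<lambda>s. (m j l + s * \<mu> j l)\<^sup>2 / (edge_mean j l \<rho> + s * edge_mean j l a)) has_real_derivative
      2 * ((m j l + s * \<mu> j l) / (edge_mean j l \<rho> + s * edge_mean j l a)) * \<mu> j l
      - ((m j l + s * \<mu> j l) / (edge_mean j l \<rho> + s * edge_mean j l a))\<^sup>2 * edge_mean j l a)
      (at s within T)" for j l
  proof -
    have "edge_mean j l \<rho> + s * edge_mean j l a \<noteq> 0"
      using edge_mean_pos[OF pos, of j l] by (simp add: edge_mean_linear)
    moreover have N: "((\<lambda>s. m j l + s * \<mu> j l) has_real_derivative \<mu> j l) (at s within T)"
      and G: "((\<lambda>s. edge_mean j l \<rho> + s * edge_mean j l a) has_real_derivative edge_mean j l a) (at s within T)"
      by (auto intro!: derivative_eq_intros)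
    ultimately show ?thesis
      by (intro DERIV_cong[OF DERIV_divide[OF DERIV_power[OF N] G]])
        (simp_all add: diff_divide_distrib power2_eq_square)
  qed
  then show ?thesis
    unfolding flux_energy_def
    by (intro DERIV_cmult DERIV_sum) (auto simp: edge_mean_linear split_beta)
qed

lemma partial_deriv_fisher_info:
  assumes "\<And>j. \<rho> $ j > 0"
  shows "partial_deriv j (fisher_info E \<omega>) \<rho> = fisher_deriv E \<omega> \<rho> (axis j 1)"
  unfolding partial_deriv_def
  using fisher_info_has_deriv[of \<rho> 0 "axis j 1" E \<omega> UNIV] assms by (auto intro: DERIV_imp_deriv)

text \<open>A linear function has the same derivative at every point, namely its value on the
  direction.\<close>

lemma partial_deriv_edge_mean:
  "partial_deriv j (edge_mean k l) \<rho> = edge_mean k l (axis j 1)"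
  unfolding partial_deriv_def edge_mean_linear
  by (rule DERIV_imp_deriv) (auto intro!: derivative_eq_intros)

lemma fisher_deriv_linear:
  "fisher_deriv E \<omega> \<rho> (a - b) = fisher_deriv E \<omega> \<rho> a - fisher_deriv E \<omega> \<rho> b"
  "fisher_deriv E \<omega> \<rho> (c *\<^sub>R a) = c * fisher_deriv E \<omega> \<rho> a"
proof -
  define d where "d a = (\<lambda>(j, l). \<omega> j l *
     (2 * (ln (\<rho> $ j) - ln (\<rho> $ l)) * (a $ j / \<rho> $ j - a $ l / \<rho> $ l) * edge_mean j l \<rho>
      + (ln (\<rho> $ j) - ln (\<rho> $ l))\<^sup>2 * edge_mean j l a))" for a
  have eq: "fisher_deriv E \<omega> \<rho> a = 1 / 2 * sum (d a) E" for a
    by (simp add: fisher_deriv_def d_def)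
  have "d (a - b) = (\<lambda>e. d a e - d b e)" "d (c *\<^sub>R a) = (\<lambda>e. c * d a e)"
    by (auto simp: d_def fun_eq_iff edge_mean_linear diff_divide_distrib algebra_simps)
  then show "fisher_deriv E \<omega> \<rho> (a - b) = fisher_deriv E \<omega> \<rho> a - fisher_deriv E \<omega> \<rho> b"
    "fisher_deriv E \<omega> \<rho> (c *\<^sub>R a) = c * fisher_deriv E \<omega> \<rho> a"
    by (simp_all add: eq sum_subtractf diff_divide_distrib flip: sum_distrib_left)
qed

lemma energy_deriv_linear:
  "energy_deriv E \<omega> h V W \<rho> (a - b) = energy_deriv E \<omega> h V W \<rho> a - energy_deriv E \<omega> h V W \<rho> b"
  "energy_deriv E \<omega> h V W \<rho> (c *\<^sub>R a) = c * energy_deriv E \<omega> h V W \<rho> a"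
  by (simp_all add: energy_deriv_def fisher_deriv_linear sum_subtractf sum_distrib_left diff_divide_distrib algebra_simps)

lemma energy_deriv_axis:
  "energy_deriv E \<omega> h V W \<rho> (axis j 1) =
    h\<^sup>2 / 8 * fisher_deriv E \<omega> \<rho> (axis j 1) + V $ j + (\<Sum>l\<in>UNIV. W $ j $ l * \<rho> $ l)"
  by (simp add: energy_deriv_def axis_def if_distrib cong: if_cong)

section \<open>Uniform bounds and small increments\<close>

lemma finite_family_bounded:
  fixes f :: "'i \<Rightarrow> real \<Rightarrow> real"
  assumes "finite I" "\<And>i. i \<in> I \<Longrightarrow> continuous_on {0..1} (f i)"
  obtains B where "B > 0" "\<And>i t. i \<in> I \<Longrightarrow> t \<in> {0..1} \<Longrightarrow> \<bar>f i t\<bar> \<le> B"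
proof -
  have "\<exists>b>0. \<forall>t\<in>{0..1}. \<bar>f i t\<bar> \<le> b" if "i \<in> I" for i
    using compact_imp_bounded[OF compact_continuous_image[OF assms(2)[OF that]]]
    by (auto simp: bounded_pos)
  then obtain b where b: "\<And>i. i \<in> I \<Longrightarrow> b i > 0" "\<And>i t. i \<in> I \<Longrightarrow> t \<in> {0..1} \<Longrightarrow> \<bar>f i t\<bar> \<le> b i"
    by metis
  show ?thesis
  \<comment> \<open>The summand 1 keeps the bound positive when \<open>I\<close> is empty, as the
    edge set of a one-vertex graph is.\<close>
  proof (rule that[of "1 + sum b I"])
    show "1 + sum b I > 0"
      using sum_nonneg[of I b] b(1) by (smt (verit))
    show "\<bar>f i t\<bar> \<le> 1 + sum b I" if "i \<in> I" "t \<in> {0..1}" for i t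
      using b(2)[OF that] member_le_sum[of i I b] b(1) assms(1) that(1) by (smt (verit) DiffD1)
  qed
qed

lemma edge_mean_commute: "edge_mean j l \<rho> = edge_mean l j \<rho>"
  by (simp add: edge_mean_def add.commute)

text \<open>Nonnegativity of \<open>B\<close> accounts for the 0 inserted into the maximum. An upper
  estimate of the norm is all that is needed to exploit criticality.\<close>

lemma field_norm_le:
  fixes E :: "('n::finite \<times> 'n) set"
  assumes "B \<ge> 0" "\<And>t j l. t \<in> {0..1} \<Longrightarrow> (j, l) \<in> E \<Longrightarrow> \<bar>w t j l\<bar> \<le> B"
  shows "field_norm E w \<le> B"
  unfolding field_norm_def
  using assms by (intro cSUP_least) (auto simp: Max_le_iff)

text \<open>If \<open>L\<close> were nonzero, the smallness hypothesis with half of its absolute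
  value would keep the difference quotients away from their limit.\<close>

lemma deriv_zero_of_small_increments:
  fixes f :: "real \<Rightarrow> real"
  assumes deriv: "(f has_real_derivative L) (at 0)"
    and small: "\<And>e. e > 0 \<Longrightarrow> \<exists>d>0. \<forall>x. \<bar>x\<bar> < d \<longrightarrow> \<bar>f x - f 0\<bar> \<le> e * \<bar>x\<bar>"
  shows "L = 0"
proof (rule ccontr)
  assume "L \<noteq> 0"
  then obtain d where d: "d > 0" "\<And>x. \<bar>x\<bar> < d \<Longrightarrow> \<bar>f x - f 0\<bar> \<le> \<bar>L\<bar> / 2 * \<bar>x\<bar>"
    using small[of "\<bar>L\<bar> / 2"] by auto
  have "((\<lambda>x. \<bar>(f x - f 0) / x\<bar>) \<longlongrightarrow> \<bar>L\<bar>) (at 0)"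
    using deriv by (intro tendsto_rabs) (simp add: has_field_derivative_iff)
  moreover have "\<forall>\<^sub>F x in at 0. \<bar>(f x - f 0) / x\<bar> \<le> \<bar>L\<bar> / 2"
    unfolding eventually_at using d
    by (intro exI[of _ d]) (auto simp: abs_divide divide_le_eq dist_real_def)
  ultimately have "\<bar>L\<bar> \<le> \<bar>L\<bar> / 2"
    by (rule tendsto_upperbound) simp
  then show False using \<open>L \<noteq> 0\<close> by simp
qed

section \<open>The critical point and its elementary properties\<close>

locale critical_path =
  fixes E :: "('n::finite \<times> 'n) set" and \<omega> :: "'n \<Rightarrow> 'n \<Rightarrow> real"
    and V :: "real ^ 'n" and W :: "real ^ 'n ^ 'n" and h :: real
    and \<rho>0 \<rho>1 :: "real ^ 'n"
    and v :: "real \<Rightarrow> 'n \<Rightarrow> 'n \<Rightarrow> real" and \<rho> :: "real \<Rightarrow> real ^ 'n"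
  assumes graph: "connected_weighted_graph E \<omega>"
    and W_sym: "\<And>j l. W $ j $ l = W $ l $ j"
    and critical: "critical_point E \<omega> h V W \<rho>0 \<rho>1 v \<rho>"
    and smooth_v: "smooth_field E v"
    and smooth_\<rho>: "smooth_unit \<rho>"
begin

lemma transports_\<rho>: "transports E \<omega> \<rho>0 \<rho>1 v \<rho>"
  using critical by (simp add: critical_point_def)

lemma \<rho>_pos: "t \<in> {0..1} \<Longrightarrow> \<rho> t $ j > 0"
  using transports_\<rho> by (auto simp: transports_def pos_densities_def)

lemma \<rho>_sum: "t \<in> {0..1} \<Longrightarrow> (\<Sum>j\<in>UNIV. \<rho> t $ j) = 1"
  using transports_\<rho> by (auto simp: transports_def pos_densities_def densities_def)

lemma v_antisym: "t \<in> {0..1} \<Longrightarrow> vector_field E (v t)"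
  using critical by (simp add: critical_point_def)

lemma smooth_v_edge: "(j, l) \<in> E \<Longrightarrow> smooth_unit (\<lambda>t. v t j l)"
  using smooth_v by (auto simp: smooth_field_def)

lemma E_sym: "sym E"
  using graph by (simp add: connected_weighted_graph_def)

lemma edge_neq: "(j, l) \<in> E \<Longrightarrow> j \<noteq> l"
  using graph by (auto simp: connected_weighted_graph_def irrefl_def)

lemma edge_sym: "(j, l) \<in> E \<Longrightarrow> (l, j) \<in> E"
  using graph by (auto simp: connected_weighted_graph_def dest: symD)

lemma \<omega>_pos: "(j, l) \<in> E \<Longrightarrow> \<omega> j l > 0"
  using graph by (auto simp: connected_weighted_graph_def)

lemma \<omega>_sym: "(j, l) \<in> E \<Longrightarrow> \<omega> l j = \<omega> j l"
  using graph by (auto simp: connected_weighted_graph_def)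

lemma E_connected: "(j, l) \<in> E\<^sup>*"
  using graph by (auto simp: connected_weighted_graph_def)

text \<open>Compactness of the time interval, applied to the reciprocals: an upper bound
  \<open>B\<close> for them is a lower bound \<open>inverse B\<close> for the densities.\<close>

lemma \<rho>_bounded_below:
  obtains r where "r > 0" "\<And>t j. t \<in> {0..1} \<Longrightarrow> \<rho> t $ j \<ge> r"
proof -
  have "continuous_on {0..1} (\<lambda>t. inverse (\<rho> t $ j))" for j
    using \<rho>_pos
    by (intro smooth_unit_continuous smooth_unit_inverse smooth_unit_vec_nth smooth_\<rho>) (metis less_irrefl)
  then obtain B where B: "B > 0" "\<And>t j. t \<in> {0..1} \<Longrightarrow> \<bar>inverse (\<rho> t $ j)\<bar> \<le> B"
    using finite_family_bounded[of UNIV "\<lambda>j t. inverse (\<rho> t $ j)"] by (metis UNIV_I finite)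
  show ?thesis
  proof (rule that[of "inverse B"])
    show "inverse B \<le> \<rho> t $ j" if "t \<in> {0..1}" for t j
      using B(2)[OF that, of j] \<rho>_pos[OF that, of j] B(1) le_imp_inverse_le[of "inverse (\<rho> t $ j)" B]
      by simp
  qed (use B in simp)
qed

end

section \<open>Admissible variations of path and flux\<close>

text \<open>A direction of variation: \<open>a\<close> perturbs the density and \<open>\<mu>\<close>
  the flux, so the mean g is already contained in \<open>\<mu>\<close>. The assumption
  \<open>a_deriv\<close> is the linear continuity equation a' = - div \<mu>; \<open>a_sum\<close>
  preserves the total mass and \<open>a_ends\<close> the boundary values.\<close>

locale flux_variation = critical_path +
  fixes a :: "real \<Rightarrow> real ^ 'n" and \<mu> :: "real \<Rightarrow> 'n \<Rightarrow> 'n \<Rightarrow> real"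
  assumes a_smooth: "\<And>j. smooth_unit (\<lambda>t. a t $ j)"
    and a_deriv: "\<And>t. t \<in> {0..1} \<Longrightarrow>
      (a has_vector_derivative (\<chi> j. \<Sum>l\<in>neighbours E j. sqrt (\<omega> j l) * \<mu> t j l)) (at t within {0..1})"
    and a_sum: "\<And>t. t \<in> {0..1} \<Longrightarrow> (\<Sum>j\<in>UNIV. a t $ j) = 0"
    and a_ends: "a 0 = 0" "a 1 = 0"
    and \<mu>_antisym: "\<And>t. t \<in> {0..1} \<Longrightarrow> vector_field E (\<mu> t)"
    and \<mu>_smooth: "smooth_field E \<mu>"
begin

definition path :: "real \<Rightarrow> real \<Rightarrow> real ^ 'n" where
  "path \<epsilon> t = \<rho> t + \<epsilon> *\<^sub>R a t"

text \<open>The solution \<delta>v of (v + \<delta>v) g(\<rho> + \<epsilon>a) = v g(\<rho>) +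
  \<epsilon>\<mu>. Linearity of g lets \<epsilon> be factored out, which makes the size
  O(\<epsilon>) visible.\<close>

definition variation :: "real \<Rightarrow> real \<Rightarrow> 'n \<Rightarrow> 'n \<Rightarrow> real" where
  "variation \<epsilon> t j l = \<epsilon> * (\<mu> t j l - v t j l * edge_mean j l (a t)) / edge_mean j l (path \<epsilon> t)"

definition flux :: "real \<Rightarrow> 'n \<Rightarrow> 'n \<Rightarrow> real" where
  "flux t j l = v t j l * edge_mean j l (\<rho> t)"

lemma smooth_\<mu>_edge: "(j, l) \<in> E \<Longrightarrow> smooth_unit (\<lambda>t. \<mu> t j l)"
  using \<mu>_smooth by (auto simp: smooth_field_def)

lemma smooth_mean_a: "smooth_unit (\<lambda>t. edge_mean j l (a t))"
  unfolding edge_mean_def by (intro smooth_unit_divide smooth_unit_add smooth_unit_const a_smooth) simp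

lemma smooth_mean_\<rho>: "smooth_unit (\<lambda>t. edge_mean j l (\<rho> t))"
  unfolding edge_mean_def by (intro smooth_unit_divide smooth_unit_add smooth_unit_const smooth_unit_vec_nth smooth_\<rho>) simp

text \<open>If the densities are at least \<open>r\<close> and the components of \<open>a\<close> at
  most \<open>M\<close> in absolute value, then
  \<open>\<bar>\<epsilon>\<bar> \<le> r / (2 * M)\<close> takes away at most half of
  \<open>r\<close>.\<close>

lemma admissible_radius:
  obtains \<delta> r where "\<delta> > 0" "r > 0" "\<And>\<epsilon> t j. \<bar>\<epsilon>\<bar> \<le> \<delta> \<Longrightarrow> t \<in> {0..1} \<Longrightarrow> path \<epsilon> t $ j \<ge> r"
proof -
  obtain r where r: "r > 0" "\<And>t j. t \<in> {0..1} \<Longrightarrow> \<rho> t $ j \<ge> r"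
    using \<rho>_bounded_below by blast
  obtain M where M: "M > 0" "\<And>t j. t \<in> {0..1} \<Longrightarrow> \<bar>a t $ j\<bar> \<le> M"
    using finite_family_bounded[of UNIV "\<lambda>j t. a t $ j"] smooth_unit_continuous[OF a_smooth]
    by (metis UNIV_I finite)
  show ?thesis
  proof (rule that[of "r / (2 * M)" "r / 2"])
    fix \<epsilon> t :: real and j
    assume \<epsilon>: "\<bar>\<epsilon>\<bar> \<le> r / (2 * M)" and t: "t \<in> {0..1}"
    have "\<bar>\<epsilon> * a t $ j\<bar> \<le> r / (2 * M) * M"
      unfolding abs_mult using \<epsilon> M(2)[OF t] by (intro mult_mono) auto
    also have "\<dots> = r / 2" using M(1) by simp
    finally show "r / 2 \<le> path \<epsilon> t $ j"
      using r(2)[OF t, of j] by (simp add: path_def)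
  qed (use r(1) M(1) in auto)
qed

context
  fixes \<epsilon> :: real
  assumes path_pos: "\<And>t j. t \<in> {0..1} \<Longrightarrow> path \<epsilon> t $ j > 0"
begin

lemma mean_path_pos: "t \<in> {0..1} \<Longrightarrow> edge_mean j l (path \<epsilon> t) > 0"
  by (rule edge_mean_pos) (rule path_pos)

lemma varied_flux:
  assumes "t \<in> {0..1}"
  shows "add_field v (variation \<epsilon>) t j l * edge_mean j l (path \<epsilon> t) = flux t j l + \<epsilon> * \<mu> t j l"
proof -
  have "variation \<epsilon> t j l * edge_mean j l (path \<epsilon> t) = \<epsilon> * (\<mu> t j l - v t j l * edge_mean j l (a t))"
    using mean_path_pos[OF assms, of j l] by (simp add: variation_def)
  then show ?thesis
    by (simp add: add_field_def flux_def path_def edge_mean_linear algebra_simps)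
qed

text \<open>The divergence sees the field only through its product with the mean, that is, through
  the flux. The equation for the varied pair is therefore the original one plus \<epsilon> times
  \<open>a_deriv\<close>.\<close>

lemma path_transported: "transports E \<omega> \<rho>0 \<rho>1 (add_field v (variation \<epsilon>)) (path \<epsilon>)"
proof -
  obtain \<rho>' where \<rho>': "continuous_on {0..1} \<rho>'"
    "\<And>t. t \<in> {0..1} \<Longrightarrow> (\<rho> has_vector_derivative \<rho>' t) (at t within {0..1})"
    "\<And>t. t \<in> {0..1} \<Longrightarrow> \<rho>' t + graph_div E \<omega> (\<rho> t) (v t) = 0"
    and ends: "\<rho> 0 = \<rho>0" "\<rho> 1 = \<rho>1"
    using transports_\<rho> unfolding transports_def by blast
  define a' where "a' t = (\<chi> j. \<Sum>l\<in>neighbours E j. sqrt (\<omega> j l) * \<mu> t j l)" for t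
  have cont: "continuous_on {0..1} (\<lambda>t. \<rho>' t + \<epsilon> *\<^sub>R a' t)"
    unfolding a'_def
    by (intro continuous_intros \<rho>'(1) continuous_on_vec_lambda smooth_unit_continuous smooth_\<mu>_edge)
      (simp add: neighbours_def)
  have deriv: "(path \<epsilon> has_vector_derivative \<rho>' t + \<epsilon> *\<^sub>R a' t) (at t within {0..1})" if "t \<in> {0..1}" for t
    unfolding path_def a'_def using \<rho>'(2)[OF that] a_deriv[OF that]
    by (auto intro!: derivative_eq_intros)
  have div: "\<rho>' t + \<epsilon> *\<^sub>R a' t + graph_div E \<omega> (path \<epsilon> t) (add_field v (variation \<epsilon>) t) = 0"
    if t: "t \<in> {0..1}" for t
  proof -
    have "graph_div E \<omega> (path \<epsilon> t) (add_field v (variation \<epsilon>) t) =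
        - (\<chi> j. \<Sum>l\<in>neighbours E j. sqrt (\<omega> j l) * (flux t j l + \<epsilon> * \<mu> t j l))"
      unfolding graph_div_def mult.assoc varied_flux[OF t] ..
    also have "\<dots> = graph_div E \<omega> (\<rho> t) (v t) - \<epsilon> *\<^sub>R a' t"
      by (simp add: vec_eq_iff graph_div_def a'_def flux_def distrib_left sum.distrib
          sum_distrib_left mult_ac)
    finally show ?thesis using \<rho>'(3)[OF t] by simp
  qed
  have "path \<epsilon> t \<in> pos_densities" if "t \<in> {0..1}" for t
    using path_pos[OF that] \<rho>_sum[OF that] a_sum[OF that]
    by (auto simp: pos_densities_def densities_def path_def sum.distrib less_imp_le simp flip: sum_distrib_left)
  moreover have "path \<epsilon> 0 = \<rho>0" "path \<epsilon> 1 = \<rho>1"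
    by (simp_all add: path_def a_ends ends)
  ultimately show ?thesis
    unfolding transports_def using cont deriv div by blast
qed

text \<open>Antisymmetry survives because the mean is symmetric in its indices, and smoothness
  because the explicit formula divides by a positive smooth function.\<close>

lemma variation_admissible: "variation \<epsilon> \<in> variations E \<omega> \<rho>0 \<rho>1 v"
proof -
  have "vector_field E (variation \<epsilon> t)" if "t \<in> {0..1}" for t
  proof -
    have "variation \<epsilon> t l j = - variation \<epsilon> t j l" if "(j, l) \<in> E" for j l
    proof -
      have "v t l j = - v t j l" "\<mu> t l j = - \<mu> t j l"
        using v_antisym[OF \<open>t \<in> {0..1}\<close>] \<mu>_antisym[OF \<open>t \<in> {0..1}\<close>] that by (auto simp: vector_field_def)
      then show ?thesis
        by (simp add: variation_def edge_mean_commute[of l j] diff_divide_distrib right_diff_distrib)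
    qed
    then show ?thesis by (auto simp: vector_field_def)
  qed
  moreover have "smooth_unit (\<lambda>t. variation \<epsilon> t j l)" if "(j, l) \<in> E" for j l
  proof -
    have "smooth_unit (\<lambda>t. edge_mean j l (path \<epsilon> t))"
      unfolding path_def edge_mean_linear
      by (intro smooth_unit_add smooth_unit_mult smooth_unit_const smooth_mean_a smooth_mean_\<rho>)
    moreover have "edge_mean j l (path \<epsilon> t) \<noteq> 0" if "t \<in> {0..1}" for t
      using mean_path_pos[OF that, of j l] by simp
    ultimately show ?thesis
      unfolding variation_def
      by (intro smooth_unit_divide smooth_unit_mult smooth_unit_diff smooth_unit_const
          smooth_\<mu>_edge smooth_v_edge smooth_mean_a that)
  qed
  ultimately show ?thesis
    using path_transported by (auto simp: variations_def smooth_field_def)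
qed

text \<open>Rewriting v^2 g as m^2 / g makes the integrand an explicit function of \<epsilon>, in
  which flux and density are both affine.\<close>

lemma action_path:
  "action E \<omega> h V W (add_field v (variation \<epsilon>)) (path \<epsilon>) =
    integral {0..1} (\<lambda>t. flux_energy E (\<lambda>j l. flux t j l + \<epsilon> * \<mu> t j l) (path \<epsilon> t)
      - potential_energy E \<omega> h V W (path \<epsilon> t))"
  unfolding action_def
proof (rule integral_cong)
  fix t :: real assume t: "t \<in> {0..1}"
  have "add_field v (variation \<epsilon>) t j l * add_field v (variation \<epsilon>) t j l * edge_mean j l (path \<epsilon> t) =
      (flux t j l + \<epsilon> * \<mu> t j l)\<^sup>2 / edge_mean j l (path \<epsilon> t)" for j l
    using mean_path_pos[OF t, of j l]
    by (simp add: varied_flux[OF t, symmetric] power2_eq_square)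
  then have "1 / 2 * field_inner E (path \<epsilon> t) (add_field v (variation \<epsilon>) t) (add_field v (variation \<epsilon>) t) =
      flux_energy E (\<lambda>j l. flux t j l + \<epsilon> * \<mu> t j l) (path \<epsilon> t)"
    by (simp add: field_inner_def flux_energy_def)
  then show "1 / 2 * field_inner E (path \<epsilon> t) (add_field v (variation \<epsilon>) t) (add_field v (variation \<epsilon>) t)
      - h\<^sup>2 / 8 * fisher_info E \<omega> (path \<epsilon> t) - linear_potential V (path \<epsilon> t)
      - interaction_potential W (path \<epsilon> t) =
      flux_energy E (\<lambda>j l. flux t j l + \<epsilon> * \<mu> t j l) (path \<epsilon> t) - potential_energy E \<omega> h V W (path \<epsilon> t)"
    by (simp add: potential_energy_def)
qed

end

end

section \<open>The first variation of the action\<close>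

lemmas continuous_on_arith = continuous_on_const continuous_on_add continuous_on_diff
  continuous_on_mult continuous_on_divide continuous_on_ln continuous_on_power continuous_on_sum

context
  fixes X :: "'x::topological_space set" and R A :: "'x \<Rightarrow> real ^ 'n::finite"
  assumes R_cont: "\<And>j. continuous_on X (\<lambda>z. R z $ j)"
    and R_pos: "\<And>z j. z \<in> X \<Longrightarrow> R z $ j > 0"
begin

lemma components_nonzero: "z \<in> X \<Longrightarrow> R z $ j \<noteq> 0"
  using R_pos by (metis less_irrefl)

lemma continuous_on_edge_mean: "continuous_on X (\<lambda>z. edge_mean j l (R z))"
  unfolding edge_mean_def by (intro continuous_on_arith R_cont) simp

lemma continuous_on_potential_energy: "continuous_on X (\<lambda>z. potential_energy E \<omega> h V W (R z))"
  unfolding potential_energy_def fisher_info_def linear_potential_def interaction_potential_def split_beta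
  by (intro continuous_on_arith R_cont continuous_on_edge_mean ballI components_nonzero)

lemma continuous_on_energy_deriv:
  assumes "\<And>j. continuous_on X (\<lambda>z. A z $ j)"
  shows "continuous_on X (\<lambda>z. energy_deriv E \<omega> h V W (R z) (A z))"
proof -
  have A: "continuous_on X (\<lambda>z. edge_mean j l (A z))" for j l
    unfolding edge_mean_def by (intro continuous_on_arith assms) simp
  show ?thesis
    unfolding energy_deriv_def fisher_deriv_def split_beta
    by (intro continuous_on_arith R_cont assms continuous_on_edge_mean A ballI components_nonzero)
qed

end

context flux_variation
begin

lemma path_zero: "path 0 t = \<rho> t"
  by (simp add: path_def)

lemma smooth_flux: "(j, l) \<in> E \<Longrightarrow> smooth_unit (\<lambda>t. flux t j l)"
  unfolding flux_def by (intro smooth_unit_mult smooth_v_edge smooth_mean_\<rho>)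

definition action_deriv :: "real \<Rightarrow> real \<Rightarrow> real" where
  "action_deriv \<epsilon> t = 1 / 4 * (\<Sum>(j, l)\<in>E.
      2 * ((flux t j l + \<epsilon> * \<mu> t j l) / edge_mean j l (path \<epsilon> t)) * \<mu> t j l
      - ((flux t j l + \<epsilon> * \<mu> t j l) / edge_mean j l (path \<epsilon> t))\<^sup>2 * edge_mean j l (a t))
    - energy_deriv E \<omega> h V W (path \<epsilon> t) (a t)"

text \<open>Leibniz' rule on the compact rectangle of parameters and times: all densities are
  positive there, so the integrand and its \<epsilon>-derivative are jointly continuous.\<close>

lemma action_path_has_deriv:
  assumes \<delta>: "\<delta> > 0" and pos: "\<And>\<epsilon> t j. \<bar>\<epsilon>\<bar> \<le> \<delta> \<Longrightarrow> t \<in> {0..1} \<Longrightarrow> path \<epsilon> t $ j > 0"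
  shows "((\<lambda>\<epsilon>. action E \<omega> h V W (add_field v (variation \<epsilon>)) (path \<epsilon>)) has_real_derivative
    integral {0..1} (action_deriv 0)) (at 0)"
proof -
  define F where "F \<epsilon> t = flux_energy E (\<lambda>j l. flux t j l + \<epsilon> * \<mu> t j l) (path \<epsilon> t)
      - potential_energy E \<omega> h V W (path \<epsilon> t)" for \<epsilon> t
  let ?U = "{-\<delta>..\<delta>}"
  let ?X = "?U \<times> {0..1::real}"
  have snd: "continuous_on ?X (\<lambda>z. f (snd z))" if "continuous_on {0..1} f" for f :: "real \<Rightarrow> real"
    by (rule continuous_on_compose2[OF that continuous_on_snd[OF continuous_on_id]]) auto
  have path_cont: "continuous_on ?X (\<lambda>z. path (fst z) (snd z) $ j)" for j
    unfolding path_def vector_add_component vector_scaleR_component real_scaleR_def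
    by (intro continuous_on_arith continuous_on_fst continuous_on_id snd smooth_unit_continuous a_smooth smooth_unit_vec_nth smooth_\<rho>)
  have path_pos: "path (fst z) (snd z) $ j > 0" if "z \<in> ?X" for z j
    using that by (intro pos) auto
  note mean_cont = continuous_on_edge_mean[where R = "\<lambda>z. path (fst z) (snd z)", OF path_cont path_pos]
  have mean_nz: "\<forall>z\<in>?X. edge_mean j l (path (fst z) (snd z)) \<noteq> 0" for j l
    using edge_mean_pos[OF path_pos] by (metis less_irrefl)
  have edge_cont: "continuous_on ?X (\<lambda>z. flux (snd z) (fst e) (snd e))"
    "continuous_on ?X (\<lambda>z. \<mu> (snd z) (fst e) (snd e))" if "e \<in> E" for e
    using that by (intro snd smooth_unit_continuous smooth_flux smooth_\<mu>_edge; simp)+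
  have F_cont: "continuous_on ?X (\<lambda>z. F (fst z) (snd z))"
    unfolding F_def flux_energy_def split_beta
    by (intro continuous_on_arith continuous_on_potential_energy path_cont path_pos mean_cont
        mean_nz edge_cont continuous_on_fst continuous_on_id)
  have "continuous_on {0..1} (F \<epsilon>)" if "\<epsilon> \<in> ?U" for \<epsilon>
  proof -
    have "continuous_on {0..1} (\<lambda>t. (\<epsilon>, t))" "(\<lambda>t. (\<epsilon>, t)) ` {0..1} \<subseteq> ?X"
      using that by (auto intro: continuous_intros)
    from continuous_on_compose2[OF F_cont this] show ?thesis by simp
  qed
  then have int: "F \<epsilon> integrable_on cbox 0 1" if "\<epsilon> \<in> ?U" for \<epsilon>
    using that by (simp add: integrable_continuous_real)
  have cont: "continuous_on (?U \<times> cbox 0 1) (\<lambda>(\<epsilon>, t). action_deriv \<epsilon> t)"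
    unfolding action_deriv_def split_beta cbox_interval
    by (intro continuous_on_arith continuous_on_energy_deriv path_cont path_pos mean_cont
        mean_nz edge_cont continuous_on_fst continuous_on_id snd smooth_unit_continuous a_smooth smooth_mean_a)
  have deriv: "((\<lambda>\<epsilon>. F \<epsilon> t) has_real_derivative action_deriv \<epsilon> t) (at \<epsilon> within ?U)"
    if "\<epsilon> \<in> ?U" "t \<in> cbox 0 1" for \<epsilon> t
  proof -
    have "(\<rho> t + \<epsilon> *\<^sub>R a t) $ j > 0" for j
      using pos[of \<epsilon> t j] that by (auto simp: path_def)
    from DERIV_diff[OF flux_energy_has_deriv[OF this] potential_energy_has_deriv[OF W_sym this]]
    show ?thesis
      unfolding F_def action_deriv_def path_def .
  qed
  have "((\<lambda>\<epsilon>. integral (cbox 0 1) (F \<epsilon>)) has_real_derivative integral (cbox 0 1) (action_deriv 0))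
      (at 0 within ?U)"
    by (rule leibniz_rule_field_derivative[OF deriv int cont]) (use \<delta> in auto)
  moreover have "at 0 within ?U = at (0::real)"
    by (rule at_within_interior) (use \<delta> in simp)
  ultimately have "((\<lambda>\<epsilon>. integral {0..1} (F \<epsilon>)) has_real_derivative integral {0..1} (action_deriv 0)) (at 0)"
    by (simp only: cbox_interval)
  \<comment> \<open>The action agrees with the integral of \<open>F\<close> only where the varied
    densities are positive, so the derivative is transferred on an open interval around 0.\<close>
  then show ?thesis
  proof (rule has_field_derivative_transform_within_open[where S = "{-\<delta><..<\<delta>}"])
    show "integral {0..1} (F \<epsilon>) = action E \<omega> h V W (add_field v (variation \<epsilon>)) (path \<epsilon>)"
      if "\<epsilon> \<in> {-\<delta><..<\<delta>}" for \<epsilon>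
      unfolding F_def by (rule action_path[symmetric], rule pos) (use that in auto)
  qed (use \<delta> in auto)
qed

text \<open>The variation has norm at most \<open>K / r * \<bar>\<epsilon>\<bar>\<close>, so an
  increment that is small compared with the norm is also small compared with \<epsilon>, and the
  derivative at 0 vanishes.\<close>

lemma first_variation_zero: "integral {0..1} (action_deriv 0) = 0"
proof -
  obtain \<delta> r where \<delta>: "\<delta> > 0" and r: "r > 0"
    and path_ge: "\<And>\<epsilon> t j. \<bar>\<epsilon>\<bar> \<le> \<delta> \<Longrightarrow> t \<in> {0..1} \<Longrightarrow> path \<epsilon> t $ j \<ge> r"
    using admissible_radius by blast
  have path_pos: "path \<epsilon> t $ j > 0" if "\<bar>\<epsilon>\<bar> \<le> \<delta>" "t \<in> {0..1}" for \<epsilon> t j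
    using path_ge[OF that, of j] r by simp
  define d where "d e t = \<mu> t (fst e) (snd e) - v t (fst e) (snd e) * edge_mean (fst e) (snd e) (a t)" for e t
  have "continuous_on {0..1} (d e)" if "e \<in> E" for e
    unfolding d_def using that by (intro smooth_unit_continuous smooth_unit_diff smooth_unit_mult
        smooth_mean_a smooth_\<mu>_edge smooth_v_edge) simp_all
  then obtain K where K: "K > 0" "\<And>e t. e \<in> E \<Longrightarrow> t \<in> {0..1} \<Longrightarrow> \<bar>d e t\<bar> \<le> K"
    using finite_family_bounded[of E d] by (metis finite)
  have norm: "field_norm E (variation \<epsilon>) \<le> K / r * \<bar>\<epsilon>\<bar>" if \<epsilon>: "\<bar>\<epsilon>\<bar> \<le> \<delta>" for \<epsilon>
  proof (rule field_norm_le)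
    fix t :: real and j l assume t: "t \<in> {0..1}" and e: "(j, l) \<in> E"
    have "edge_mean j l (path \<epsilon> t) \<ge> r"
      using path_ge[OF \<epsilon> t, of j] path_ge[OF \<epsilon> t, of l] by (simp add: edge_mean_def)
    moreover have "\<bar>\<epsilon>\<bar> * \<bar>\<mu> t j l - v t j l * edge_mean j l (a t)\<bar> \<le> \<bar>\<epsilon>\<bar> * K"
      using K(2)[OF e t] by (intro mult_left_mono) (auto simp: d_def)
    ultimately have "\<bar>variation \<epsilon> t j l\<bar> \<le> \<bar>\<epsilon>\<bar> * K / r"
      unfolding variation_def abs_divide abs_mult using r K(1)
      by (intro frac_le) auto
    then show "\<bar>variation \<epsilon> t j l\<bar> \<le> K / r * \<bar>\<epsilon>\<bar>" by (simp add: mult.commute)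
  qed (use K(1) r in simp)
  let ?f = "\<lambda>\<epsilon>. action E \<omega> h V W (add_field v (variation \<epsilon>)) (path \<epsilon>)"
  have f0: "?f 0 = action E \<omega> h V W v \<rho>"
  proof -
    have "add_field v (variation 0) = v" "path 0 = \<rho>"
      by (simp_all add: fun_eq_iff add_field_def variation_def path_def)
    then show ?thesis by simp
  qed
  show ?thesis
  proof (rule deriv_zero_of_small_increments[of ?f])
    show "(?f has_real_derivative integral {0..1} (action_deriv 0)) (at 0)"
      using \<delta> path_pos by (rule action_path_has_deriv)
    fix e :: real assume e: "e > 0"
    \<comment> \<open>Chosen so that \<open>e'\<close> times the norm bound
      \<open>K / r * \<bar>\<epsilon>\<bar>\<close> is exactly
      \<open>e * \<bar>\<epsilon>\<bar>\<close>.\<close>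
    define e' where "e' = e * r / K"
    have e': "e' > 0" using e r K(1) by (simp add: e'_def)
    have "\<exists>\<eta>>0. \<forall>\<delta>v\<in>variations E \<omega> \<rho>0 \<rho>1 v. field_norm E \<delta>v < \<eta> \<longrightarrow>
        (\<forall>\<sigma>. transports E \<omega> \<rho>0 \<rho>1 (add_field v \<delta>v) \<sigma> \<longrightarrow>
           \<bar>action E \<omega> h V W (add_field v \<delta>v) \<sigma> - action E \<omega> h V W v \<rho>\<bar>
             \<le> e' * field_norm E \<delta>v)"
      using critical e' by (simp only: critical_point_def)
    then obtain \<eta> where \<eta>: "\<eta> > 0"
      "\<And>\<delta>v \<sigma>. \<delta>v \<in> variations E \<omega> \<rho>0 \<rho>1 v \<Longrightarrow> field_norm E \<delta>v < \<eta> \<Longrightarrow>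
        transports E \<omega> \<rho>0 \<rho>1 (add_field v \<delta>v) \<sigma> \<Longrightarrow>
        \<bar>action E \<omega> h V W (add_field v \<delta>v) \<sigma> - action E \<omega> h V W v \<rho>\<bar> \<le> e' * field_norm E \<delta>v"
      by metis
    \<comment> \<open>In the radius below, \<open>\<delta>\<close> guarantees positive densities,
      and \<open>\<eta> * r / K\<close> pushes the norm of the variation below
      \<open>\<eta>\<close>.\<close>
    show "\<exists>d>0. \<forall>\<epsilon>. \<bar>\<epsilon>\<bar> < d \<longrightarrow> \<bar>?f \<epsilon> - ?f 0\<bar> \<le> e * \<bar>\<epsilon>\<bar>"
    proof (intro exI[of _ "min \<delta> (\<eta> * r / K)"] conjI allI impI)
      show "min \<delta> (\<eta> * r / K) > 0" using \<delta> \<eta>(1) r K(1) by simp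
      fix \<epsilon> :: real assume "\<bar>\<epsilon>\<bar> < min \<delta> (\<eta> * r / K)"
      then have \<epsilon>: "\<bar>\<epsilon>\<bar> \<le> \<delta>" "K / r * \<bar>\<epsilon>\<bar> < \<eta>"
        using r K(1) by (auto simp: field_simps)
      have "\<bar>?f \<epsilon> - ?f 0\<bar> \<le> e' * field_norm E (variation \<epsilon>)"
        unfolding f0
        by (rule \<eta>(2)[OF variation_admissible[OF path_pos] order.strict_trans1[OF norm \<epsilon>(2)]
            path_transported[OF path_pos]]) (rule \<epsilon>(1) | assumption)+
      also have "\<dots> \<le> e' * (K / r * \<bar>\<epsilon>\<bar>)"
        using norm[OF \<epsilon>(1)] e' by (intro mult_left_mono) auto
      also have "\<dots> = e * \<bar>\<epsilon>\<bar>" using r K(1) by (simp add: e'_def)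
      finally show "\<bar>?f \<epsilon> - ?f 0\<bar> \<le> e * \<bar>\<epsilon>\<bar>" .
    qed
  qed
qed

text \<open>At \<epsilon> = 0 the quotient of flux and mean is the original velocity, which turns
  \<open>action_deriv\<close> into the integrand of the overview.\<close>

lemma first_variation:
  "integral {0..1} (\<lambda>t. 1 / 2 * (\<Sum>(j, l)\<in>E. v t j l * \<mu> t j l)
    - 1 / 4 * (\<Sum>(j, l)\<in>E. (v t j l)\<^sup>2 * edge_mean j l (a t))
    - energy_deriv E \<omega> h V W (\<rho> t) (a t)) = 0"
proof -
  have "action_deriv 0 t = 1 / 2 * (\<Sum>(j, l)\<in>E. v t j l * \<mu> t j l)
    - 1 / 4 * (\<Sum>(j, l)\<in>E. (v t j l)\<^sup>2 * edge_mean j l (a t))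
    - energy_deriv E \<omega> h V W (\<rho> t) (a t)" if "t \<in> {0..1}" for t
  proof -
    have "flux t j l / edge_mean j l (\<rho> t) = v t j l" for j l
      using edge_mean_pos[OF \<rho>_pos[OF that], of j l] by (simp add: flux_def)
    then have "action_deriv 0 t = 1 / 4 * (\<Sum>(j, l)\<in>E. 2 * v t j l * \<mu> t j l - (v t j l)\<^sup>2 * edge_mean j l (a t))
        - energy_deriv E \<omega> h V W (\<rho> t) (a t)"
      by (simp add: action_deriv_def path_zero)
    also have "(\<Sum>(j, l)\<in>E. 2 * v t j l * \<mu> t j l - (v t j l)\<^sup>2 * edge_mean j l (a t)) =
        2 * (\<Sum>(j, l)\<in>E. v t j l * \<mu> t j l) - (\<Sum>(j, l)\<in>E. (v t j l)\<^sup>2 * edge_mean j l (a t))"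
      by (simp add: split_beta sum_subtractf sum_distrib_left mult.assoc)
    finally show ?thesis by simp
  qed
  then have "integral {0..1} (action_deriv 0) = integral {0..1} (\<lambda>t. 1 / 2 * (\<Sum>(j, l)\<in>E. v t j l * \<mu> t j l)
    - 1 / 4 * (\<Sum>(j, l)\<in>E. (v t j l)\<^sup>2 * edge_mean j l (a t))
    - energy_deriv E \<omega> h V W (\<rho> t) (a t))"
    by (rule integral_cong)
  then show ?thesis using first_variation_zero by simp
qed

end

section \<open>Gradients and divergence-free fields on the graph\<close>

lemma has_vector_derivative_vec_lambda:
  fixes f :: "'n::finite \<Rightarrow> real \<Rightarrow> real"
  assumes "\<And>j. (f j has_vector_derivative f' j) (at t within T)"
  shows "((\<lambda>t. \<chi> j. f j t) has_vector_derivative (\<chi> j. f' j)) (at t within T)"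
proof -
  have eq: "(\<chi> j. x j) = (\<Sum>j\<in>UNIV. x j *\<^sub>R axis j (1::real))" for x :: "'n \<Rightarrow> real"
    by (simp add: vec_eq_iff axis_def if_distrib cong: if_cong)
  show ?thesis
    unfolding eq
    by (intro has_vector_derivative_sum bounded_linear.has_vector_derivative[OF bounded_linear_scaleR_left] assms)
qed

text \<open>Testing an edge sum against a unit vector localizes it at one vertex. With its companion
  for the second index, this extracts divergences and vertex-wise equations from sums over
  \<open>E\<close>.\<close>

lemma sum_edges_first:
  fixes f :: "'n::finite \<Rightarrow> 'n \<Rightarrow> real"
  shows "(\<Sum>(j, l)\<in>E. f j l * axis k 1 $ j) = (\<Sum>l\<in>neighbours E k. f k l)"
proof -
  have "E = Sigma UNIV (neighbours E)" by (auto simp: neighbours_def)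
  then have "(\<Sum>(j, l)\<in>E. f j l * axis k 1 $ j) = (\<Sum>j\<in>UNIV. \<Sum>l\<in>neighbours E j. f j l * axis k 1 $ j)"
    by (simp add: sum.Sigma)
  also have "\<dots> = (\<Sum>j\<in>UNIV. if j = k then \<Sum>l\<in>neighbours E j. f j l else 0)"
    by (intro sum.cong refl) (simp add: axis_def)
  finally show ?thesis by simp
qed

lemma sum_edges_second:
  fixes f :: "'n::finite \<Rightarrow> 'n \<Rightarrow> real"
  assumes "sym E"
  shows "(\<Sum>(j, l)\<in>E. f j l * axis k 1 $ l) = (\<Sum>l\<in>neighbours E k. f l k)"
proof -
  have "(\<Sum>(j, l)\<in>E. f j l * axis k 1 $ l) = (\<Sum>(j, l)\<in>E. f l j * axis k 1 $ j)"
    by (rule sum.reindex_bij_witness[of _ prod.swap prod.swap]) (use assms in \<open>auto dest: symD\<close>)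
  then show ?thesis by (simp add: sum_edges_first)
qed

text \<open>The discrete Helmholtz decomposition. The part \<open>z\<close> of \<open>u\<close>
  orthogonal to all gradients is divergence free, hence orthogonal to \<open>u\<close> by
  \<open>orth\<close> and to the gradient part by construction; so it is orthogonal to itself on the
  edges and vanishes there.\<close>

lemma gradient_if_orthogonal_to_divergence_free:
  fixes E :: "('n::finite \<times> 'n) set"
  assumes sym: "sym E" and \<omega>_sym: "\<And>j l. (j, l) \<in> E \<Longrightarrow> \<omega> l j = \<omega> j l"
    and u: "vector_field E u"
    and orth: "\<And>c. vector_field E c \<Longrightarrow> (\<And>j. (\<Sum>l\<in>neighbours E j. sqrt (\<omega> j l) * c j l) = 0) \<Longrightarrow>
      (\<Sum>(j, l)\<in>E. u j l * c j l) = 0"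
  shows "\<exists>S :: real ^ 'n. \<forall>(j, l)\<in>E. u j l = sqrt (\<omega> j l) * (S $ j - S $ l)"
proof -
  \<comment> \<open>Extension by zero off the edges places fields in a Euclidean space of matrices,
    where orthogonal projection onto the range of the gradient is available.\<close>
  define G :: "real ^ 'n \<Rightarrow> real ^ 'n ^ 'n"
    where "G S = (\<chi> j l. if (j, l) \<in> E then sqrt (\<omega> j l) * (S $ j - S $ l) else 0)" for S
  define U :: "real ^ 'n ^ 'n" where "U = (\<chi> j l. if (j, l) \<in> E then u j l else 0)"
  have "linear G"
    by (rule linearI) (simp_all add: G_def vec_eq_iff algebra_simps)
  then have span: "span (range G) = range G"
    by (simp add: span_eq_iff linear_subspace_image)
  obtain y z where y: "y \<in> span (range G)" and z: "\<And>w. w \<in> span (range G) \<Longrightarrow> orthogonal z w"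
    and U_eq: "U = y + z"
    using orthogonal_subspace_decomp_exists[of "range G" U] by metis
  obtain S where S: "y = G S" using y span by auto
  have inner: "z \<bullet> G T = (\<Sum>(j, l)\<in>E. z $ j $ l * (sqrt (\<omega> j l) * (T $ j - T $ l)))" for T
  proof -
    have "z \<bullet> G T = (\<Sum>e\<in>UNIV. if e \<in> E then z $ fst e $ snd e *
        (sqrt (\<omega> (fst e) (snd e)) * (T $ fst e - T $ snd e)) else 0)"
      unfolding inner_vec_def inner_real_def sum.cartesian_product UNIV_Times_UNIV
      by (intro sum.cong refl) (auto simp: G_def split_beta)
    then show ?thesis by (simp add: sum.If_cases split_beta)
  qed
  have z_edge: "z $ j $ l = u j l - sqrt (\<omega> j l) * (S $ j - S $ l)" if "(j, l) \<in> E" for j l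
  proof -
    have "z = U - G S" using U_eq S by simp
    then show ?thesis using that by (simp add: U_def G_def)
  qed
  have anti: "z $ l $ j = - z $ j $ l" if "(j, l) \<in> E" for j l
  proof -
    have "(l, j) \<in> E" using that sym by (auto dest: symD)
    moreover have "u l j = - u j l" using that u by (auto simp: vector_field_def)
    ultimately show ?thesis using that by (simp add: z_edge \<omega>_sym algebra_simps)
  qed
  have "(\<Sum>l\<in>neighbours E k. sqrt (\<omega> k l) * z $ k $ l) = 0" for k
  proof -
    \<comment> \<open>Pairing with the gradient of the indicator of \<open>k\<close> gives the
      weighted sum over edges leaving \<open>k\<close> minus that over edges entering it, which by
      antisymmetry is twice the former.\<close>
    have "0 = z \<bullet> G (axis k 1)"
      using z[of "G (axis k 1)"] span by (simp add: orthogonal_def)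
    also have "\<dots> = (\<Sum>(j, l)\<in>E. (sqrt (\<omega> j l) * z $ j $ l) * axis k 1 $ j)
        - (\<Sum>(j, l)\<in>E. (sqrt (\<omega> j l) * z $ j $ l) * axis k 1 $ l)"
      unfolding inner sum_subtractf[symmetric] split_beta
      by (intro sum.cong refl) (simp add: right_diff_distrib mult_ac)
    also have "\<dots> = (\<Sum>l\<in>neighbours E k. sqrt (\<omega> k l) * z $ k $ l)
        - (\<Sum>l\<in>neighbours E k. sqrt (\<omega> l k) * z $ l $ k)"
      by (simp only: sum_edges_first sum_edges_second[OF sym])
    also have "(\<Sum>l\<in>neighbours E k. sqrt (\<omega> l k) * z $ l $ k) =
        - (\<Sum>l\<in>neighbours E k. sqrt (\<omega> k l) * z $ k $ l)"
      unfolding sum_negf[symmetric]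
    proof (intro sum.cong refl)
      fix l assume "l \<in> neighbours E k"
      then show "sqrt (\<omega> l k) * z $ l $ k = - (sqrt (\<omega> k l) * z $ k $ l)"
        by (simp add: neighbours_def anti[of k l] \<omega>_sym[of k l])
    qed
    finally show ?thesis by simp
  qed
  then have "(\<Sum>(j, l)\<in>E. u j l * z $ j $ l) = 0"
    using anti by (intro orth) (auto simp: vector_field_def)
  moreover have "(\<Sum>(j, l)\<in>E. z $ j $ l * (sqrt (\<omega> j l) * (S $ j - S $ l))) = 0"
    using z[of "G S"] span inner[of S] by (simp add: orthogonal_def)
  ultimately have "(\<Sum>(j, l)\<in>E. u j l * z $ j $ l - z $ j $ l * (sqrt (\<omega> j l) * (S $ j - S $ l))) = 0"
    by (simp add: sum_subtractf split_beta)
  moreover have "(\<Sum>(j, l)\<in>E. u j l * z $ j $ l - z $ j $ l * (sqrt (\<omega> j l) * (S $ j - S $ l))) =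
      (\<Sum>(j, l)\<in>E. (z $ j $ l)\<^sup>2)"
    by (intro sum.cong refl) (auto simp: z_edge power2_eq_square algebra_simps)
  ultimately have "\<forall>e\<in>E. (case e of (j, l) \<Rightarrow> (z $ j $ l)\<^sup>2) = 0"
    by (subst sum_nonneg_eq_0_iff[symmetric]) auto
  then have "\<forall>(j, l)\<in>E. z $ j $ l = 0"
    by auto
  then show ?thesis using z_edge by (intro exI[of _ S]) auto
qed

section \<open>Existence of the potential and the Euler-Lagrange equations\<close>

context critical_path
begin

text \<open>Keep the density fixed and vary the flux by \<phi>(t) c, where \<phi> is the very
  pairing of v(t) with c. The first variation becomes the integral of \<phi>^2 / 2, and a continuous
  nonnegative function with integral zero vanishes.\<close>

lemma orthogonal_to_divergence_free:
  assumes c: "vector_field E c" "\<And>j. (\<Sum>l\<in>neighbours E j. sqrt (\<omega> j l) * c j l) = 0"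
    and t: "t \<in> {0..1}"
  shows "(\<Sum>(j, l)\<in>E. v t j l * c j l) = 0"
proof -
  define \<phi> where "\<phi> t = (\<Sum>e\<in>E. v t (fst e) (snd e) * c (fst e) (snd e))" for t
  have \<phi>: "smooth_unit \<phi>"
    unfolding \<phi>_def by (intro smooth_unit_sum smooth_unit_mult smooth_unit_const smooth_v_edge) simp_all
  interpret flux_variation E \<omega> V W h \<rho>0 \<rho>1 v \<rho> "\<lambda>t. 0" "\<lambda>t j l. \<phi> t * c j l"
  proof unfold_locales
    have "(\<chi> j. \<Sum>l\<in>neighbours E j. sqrt (\<omega> j l) * (\<phi> t * c j l)) = 0" for t
      using c(2) by (simp add: vec_eq_iff mult.left_commute flip: sum_distrib_left)
    then show "((\<lambda>t. 0) has_vector_derivative (\<chi> j. \<Sum>l\<in>neighbours E j. sqrt (\<omega> j l) * (\<phi> t * c j l)))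
        (at t within {0..1})" for t :: real
      by (simp only: has_vector_derivative_const)
  next
    show "smooth_field E (\<lambda>t j l. \<phi> t * c j l)"
      unfolding smooth_field_def split_beta by (intro ballI smooth_unit_mult \<phi> smooth_unit_const)
    show "vector_field E (\<lambda>j l. \<phi> t * c j l)" for t
      using c(1) by (auto simp: vector_field_def)
  qed (simp_all add: smooth_unit_const)
  have "(\<Sum>(j, l)\<in>E. v t j l * (\<phi> t * c j l)) = (\<phi> t)\<^sup>2" for t
    by (simp add: \<phi>_def split_beta power2_eq_square sum_distrib_left mult_ac)
  moreover have "energy_deriv E \<omega> h V W r 0 = 0" for r
    using energy_deriv_linear(2)[where c = 0] by simp
  moreover have "edge_mean j l 0 = 0" for j l :: 'n
    by (simp add: edge_mean_def)
  moreover have "(\<Sum>(j, l)\<in>E. 0) = (0::real)"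
    by (simp add: split_beta)
  ultimately have "integral {0..1} (\<lambda>t. 1 / 2 * (\<phi> t)\<^sup>2) = 0"
    using first_variation by (simp only: mult_zero_right diff_0_right)
  moreover have "continuous_on {0..1} (\<lambda>t. 1 / 2 * (\<phi> t)\<^sup>2)"
    by (intro smooth_unit_continuous smooth_unit_mult smooth_unit_power smooth_unit_const \<phi>)
  ultimately have "1 / 2 * (\<phi> t)\<^sup>2 = 0"
    using t by (subst (asm) integral_eq_0_iff) auto
  then show ?thesis by (simp add: \<phi>_def split_beta)
qed

text \<open>The potential is chosen separately at each time, so it need not depend on time in any
  regular way.\<close>

lemma potential_exists: "\<exists>S. induces E \<omega> S v"
proof -
  have "\<exists>S :: real ^ 'n. \<forall>(j, l)\<in>E. v t j l = sqrt (\<omega> j l) * (S $ j - S $ l)" if "t \<in> {0..1}" for t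
    using E_sym \<omega>_sym v_antisym[OF that] orthogonal_to_divergence_free[OF _ _ that]
    by (rule gradient_if_orthogonal_to_divergence_free)
  then obtain S :: "real \<Rightarrow> real ^ 'n"
    where "\<forall>t\<in>{0..1}. \<forall>(j, l)\<in>E. v t j l = sqrt (\<omega> j l) * (S t $ j - S t $ l)"
    using bchoice[of "{0..1}" "\<lambda>t S. \<forall>(j, l)\<in>E. v t j l = sqrt (\<omega> j l) * (S $ j - S $ l)"] by blast
  then show ?thesis unfolding induces_def by blast
qed

text \<open>Minus the time derivative of the gauged potential at the vertex \<open>j\<close>.\<close>

definition hamiltonian_deriv :: "'n \<Rightarrow> real \<Rightarrow> real" where
  "hamiltonian_deriv j t = 1 / 4 * (\<Sum>(k, l)\<in>E. (v t k l)\<^sup>2 * edge_mean k l (axis j 1))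
    + energy_deriv E \<omega> h V W (\<rho> t) (axis j 1)"

lemma smooth_hamiltonian_deriv: "smooth_unit (hamiltonian_deriv j)"
proof -
  have \<rho>: "smooth_unit (\<lambda>t. \<rho> t $ k)" for k
    by (rule smooth_unit_vec_nth[OF smooth_\<rho>])
  have nz: "\<rho> t $ k \<noteq> 0" if "t \<in> {0..1}" for t k
    using \<rho>_pos[OF that, of k] by simp
  have mean: "smooth_unit (\<lambda>t. edge_mean k l (\<rho> t))" for k l
    unfolding edge_mean_def by (intro smooth_unit_divide smooth_unit_add smooth_unit_const \<rho>) simp
  have v: "smooth_unit (\<lambda>t. v t (fst e) (snd e))" if "e \<in> E" for e
    using that by (intro smooth_v_edge) simp
  show ?thesis
    unfolding hamiltonian_deriv_def energy_deriv_def fisher_deriv_def split_beta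
    by (intro smooth_unit_add smooth_unit_mult smooth_unit_diff smooth_unit_divide smooth_unit_power
        smooth_unit_sum smooth_unit_ln smooth_unit_const \<rho> mean v finite nz \<rho>_pos)
qed

text \<open>The Euler-Lagrange equation on one edge, from moving mass \<open>\<phi>\<close> along it. With \<open>f\<close> the
  residual of the equation, the choice \<open>\<phi>(t) = t(1 - t) f(t)\<close> makes the first variation
  \<open>\<integral> t(1 - t) f\<^sup>2\<close>.\<close>

lemma edge_euler_lagrange:
  assumes e: "(j, k) \<in> E" and t: "t \<in> {0..1}"
  shows "((\<lambda>t. v t j k / sqrt (\<omega> j k)) has_vector_derivative
    hamiltonian_deriv k t - hamiltonian_deriv j t) (at t within {0..1})"
proof -
  define c where "c = sqrt (\<omega> j k)"
  have c: "c \<noteq> 0" "sqrt (\<omega> k j) = c"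
    using \<omega>_pos[OF e] \<omega>_sym[OF e] by (simp_all add: c_def)
  \<comment> \<open>This is the potential difference along the edge, expressed through
    \<open>v\<close> so that its smoothness does not depend on a choice of potential.\<close>
  define p where "p t = v t j k / c" for t
  have "smooth_unit p"
    unfolding p_def using c(1) by (intro smooth_unit_divide smooth_v_edge e smooth_unit_const)
  from smooth_unit_obtain_deriv[OF this] obtain p' where p': "smooth_unit p'"
    "\<And>t. t \<in> {0..1} \<Longrightarrow> (p has_vector_derivative p' t) (at t within {0..1})"
    by blast
  define f where "f t = p' t + hamiltonian_deriv j t - hamiltonian_deriv k t" for t
  have f: "smooth_unit f"
    unfolding f_def by (intro smooth_unit_add smooth_unit_diff p'(1) smooth_hamiltonian_deriv)
  define \<phi> where "\<phi> t = t * (1 - t) * f t" for t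
  have \<phi>: "smooth_unit \<phi>"
    unfolding \<phi>_def by (intro smooth_unit_mult smooth_unit_diff smooth_unit_ident smooth_unit_const f)
  from smooth_unit_obtain_deriv[OF this] obtain \<phi>' where \<phi>': "smooth_unit \<phi>'"
    "\<And>t. t \<in> {0..1} \<Longrightarrow> (\<phi> has_vector_derivative \<phi>' t) (at t within {0..1})"
    by blast
  define d :: "real ^ 'n" where "d = axis j 1 - axis k 1"
  \<comment> \<open>An antisymmetric flux on this one edge; dividing by \<open>c\<close> cancels the
    weight, so the mass rate is \<phi>' at \<open>j\<close> and its negative at
    \<open>k\<close>.\<close>
  define \<mu> where "\<mu> t x y = \<phi>' t / c * (of_bool (x = j \<and> y = k) - of_bool (x = k \<and> y = j))" for t x y
  note jk = edge_neq[OF e]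
  have div_\<mu>: "(\<chi> x. \<Sum>l\<in>neighbours E x. sqrt (\<omega> x l) * \<mu> t x l) = \<phi>' t *\<^sub>R d" for t
  proof -
    have "(\<Sum>l\<in>neighbours E j. sqrt (\<omega> j l) * \<mu> t j l) = (\<Sum>l\<in>neighbours E j. if l = k then \<phi>' t else 0)"
      by (intro sum.cong refl) (use jk c in \<open>auto simp: \<mu>_def c_def\<close>)
    moreover have "(\<Sum>l\<in>neighbours E k. sqrt (\<omega> k l) * \<mu> t k l) = (\<Sum>l\<in>neighbours E k. if l = j then - \<phi>' t else 0)"
      by (intro sum.cong refl) (use jk c in \<open>auto simp: \<mu>_def\<close>)
    moreover have "(\<Sum>l\<in>neighbours E x. sqrt (\<omega> x l) * \<mu> t x l) = 0" if "x \<noteq> j" "x \<noteq> k" for x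
      using that by (simp add: \<mu>_def)
    ultimately show ?thesis
      using e edge_sym[OF e] jk by (auto simp: vec_eq_iff d_def axis_def neighbours_def)
  qed
  interpret flux_variation E \<omega> V W h \<rho>0 \<rho>1 v \<rho> "\<lambda>t. \<phi> t *\<^sub>R d" \<mu>
  proof unfold_locales
    show "smooth_unit (\<lambda>t. (\<phi> t *\<^sub>R d) $ x)" for x
      unfolding vector_scaleR_component real_scaleR_def by (intro smooth_unit_mult \<phi> smooth_unit_const)
    show "((\<lambda>t. \<phi> t *\<^sub>R d) has_vector_derivative (\<chi> x. \<Sum>l\<in>neighbours E x. sqrt (\<omega> x l) * \<mu> t x l))
        (at t within {0..1})" if "t \<in> {0..1}" for t
      unfolding div_\<mu>
      by (rule bounded_linear.has_vector_derivative[OF bounded_linear_scaleR_left \<phi>'(2)[OF that]])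
    have "(\<Sum>x\<in>UNIV. d $ x) = 0"
      by (simp add: d_def axis_def sum_subtractf)
    then show "(\<Sum>x\<in>UNIV. (\<phi> t *\<^sub>R d) $ x) = 0" for t
      unfolding vector_scaleR_component real_scaleR_def sum_distrib_left[symmetric] by simp
    show "\<phi> 0 *\<^sub>R d = 0" "\<phi> 1 *\<^sub>R d = 0"
      by (simp_all add: \<phi>_def)
    have "\<mu> t y x = - \<mu> t x y" for t x y
      unfolding \<mu>_def mult_minus_right[symmetric] minus_diff_eq by (simp only: conj_commute)
    then show "vector_field E (\<mu> t)" for t
      unfolding vector_field_def by blast
    show "smooth_field E \<mu>"
      unfolding smooth_field_def \<mu>_def split_beta
      by (rule ballI, rule smooth_unit_mult[OF smooth_unit_divide[OF \<phi>'(1) smooth_unit_const c(1)] smooth_unit_const])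
  qed
  \<comment> \<open>The factor 2 counts the two orientations of the edge, on which both fields
    change sign.\<close>
  have work: "(\<Sum>(x, y)\<in>E. v t x y * \<mu> t x y) = 2 * (p t * \<phi>' t)" if "t \<in> {0..1}" for t
  proof -
    have v: "v t k j = - v t j k"
      using v_antisym[OF that] e by (auto simp: vector_field_def)
    have "(\<Sum>(x, y)\<in>E. v t x y * \<mu> t x y) =
        (\<Sum>e\<in>E. (if e = (j, k) then p t * \<phi>' t else 0) + (if e = (k, j) then p t * \<phi>' t else 0))"
      by (intro sum.cong refl) (use jk v in \<open>auto simp: \<mu>_def p_def split_beta\<close>)
    then show ?thesis
      using e edge_sym[OF e] by (simp add: sum.distrib)
  qed
  have potential: "1 / 4 * (\<Sum>(x, y)\<in>E. (v t x y)\<^sup>2 * edge_mean x y (\<phi> t *\<^sub>R d))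
      + energy_deriv E \<omega> h V W (\<rho> t) (\<phi> t *\<^sub>R d) =
      \<phi> t * (hamiltonian_deriv j t - hamiltonian_deriv k t)" for t
  proof -
    have "(\<Sum>(x, y)\<in>E. (v t x y)\<^sup>2 * edge_mean x y (\<phi> t *\<^sub>R d)) =
        \<phi> t * ((\<Sum>(x, y)\<in>E. (v t x y)\<^sup>2 * edge_mean x y (axis j 1))
          - (\<Sum>(x, y)\<in>E. (v t x y)\<^sup>2 * edge_mean x y (axis k 1)))"
      unfolding sum_subtractf[symmetric] sum_distrib_left
      by (intro sum.cong refl) (auto simp: d_def edge_mean_linear algebra_simps)
    then show ?thesis
      by (simp add: d_def energy_deriv_linear hamiltonian_deriv_def algebra_simps)
  qed
  have "integral {0..1} (\<lambda>t. p t * \<phi>' t - \<phi> t * (hamiltonian_deriv j t - hamiltonian_deriv k t)) =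
      integral {0..1} (\<lambda>t. 1 / 2 * (\<Sum>(x, y)\<in>E. v t x y * \<mu> t x y)
        - 1 / 4 * (\<Sum>(x, y)\<in>E. (v t x y)\<^sup>2 * edge_mean x y (\<phi> t *\<^sub>R d))
        - energy_deriv E \<omega> h V W (\<rho> t) (\<phi> t *\<^sub>R d))"
    by (intro integral_cong) (simp only: work diff_diff_eq potential)
  also have "\<dots> = 0" by (rule first_variation)
  finally have var: "integral {0..1} (\<lambda>t. p t * \<phi>' t - \<phi> t * (hamiltonian_deriv j t - hamiltonian_deriv k t)) = 0" .
  \<comment> \<open>Integration by parts: the boundary terms disappear because \<phi> vanishes at
    both ends. Subtracting the first variation then leaves the integral of \<phi> f.\<close>
  have "((\<lambda>t. p t * \<phi>' t + p' t * \<phi> t) has_integral p 1 * \<phi> 1 - p 0 * \<phi> 0) {0..1}"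
    by (intro fundamental_theorem_of_calculus has_vector_derivative_mult p'(2) \<phi>'(2)) auto
  then have parts: "((\<lambda>t. p t * \<phi>' t + p' t * \<phi> t) has_integral 0) {0..1}"
    by (simp add: \<phi>_def)
  have "(\<lambda>t. p t * \<phi>' t - \<phi> t * (hamiltonian_deriv j t - hamiltonian_deriv k t)) integrable_on {0..1}"
    by (intro integrable_continuous_real smooth_unit_continuous smooth_unit_diff smooth_unit_mult
        smooth_hamiltonian_deriv \<phi> \<phi>' \<open>smooth_unit p\<close>)
  then have "((\<lambda>t. p t * \<phi>' t - \<phi> t * (hamiltonian_deriv j t - hamiltonian_deriv k t)) has_integral 0) {0..1}"
    using var by (simp add: has_integral_integral)
  from has_integral_diff[OF parts this]
  have "((\<lambda>t. \<phi> t * f t) has_integral 0) {0..1}"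
    by (simp add: f_def algebra_simps)
  then have "integral {0..1} (\<lambda>t. t * (1 - t) * (f t)\<^sup>2) = 0"
    by (intro integral_unique) (simp add: \<phi>_def power2_eq_square mult.assoc)
  moreover have "continuous_on {0..1} (\<lambda>t. t * (1 - t) * (f t)\<^sup>2)"
    by (intro smooth_unit_continuous smooth_unit_mult smooth_unit_diff smooth_unit_power
        smooth_unit_ident smooth_unit_const f)
  ultimately have zero: "\<forall>t\<in>{0..1}. t * (1 - t) * (f t)\<^sup>2 = 0"
    by (subst (asm) integral_eq_0_iff) auto
  \<comment> \<open>The weight t(1 - t) is zero at the endpoints, so the integral forces f = 0 only
    in the interior; continuity extends this to the closed interval.\<close>
  have closure: "closure {0<..<1} = {0..1::real}"
    by (rule closure_greaterThanLessThan) simp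
  have "f t = 0"
  proof (rule continuous_constant_on_closure[of "{0<..<1}" f 0 t])
    show "f x = 0" if "x \<in> {0<..<1}" for x
      using zero that by (auto dest!: bspec[of _ _ x])
  qed (simp_all only: closure smooth_unit_continuous[OF f] t)
  then have "p' t = hamiltonian_deriv k t - hamiltonian_deriv j t"
    by (simp add: f_def)
  then show ?thesis
    using p'(2)[OF t] by (simp add: p_def[abs_def] c_def)
qed

context
  fixes S assumes S: "induces E \<omega> S v"
begin

text \<open>\<open>S\<close> may fail to be continuous in time, but each of its differences is a sum
  of smooth edge quotients along a path in the connected graph. Adding the edge equations along the
  path telescopes the right-hand sides.\<close>

lemma potential_difference_deriv:
  assumes t: "t \<in> {0..1}"
  shows "((\<lambda>t. S t $ j - S t $ i) has_vector_derivative
    hamiltonian_deriv i t - hamiltonian_deriv j t) (at t within {0..1})"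
  using E_connected[of i j]
proof (induction rule: rtrancl_induct)
  case (step j k)
  have "((\<lambda>t. S t $ j - S t $ i - v t j k / sqrt (\<omega> j k)) has_vector_derivative
      hamiltonian_deriv i t - hamiltonian_deriv j t - (hamiltonian_deriv k t - hamiltonian_deriv j t))
      (at t within {0..1})"
    by (intro has_vector_derivative_diff step.IH edge_euler_lagrange step.hyps t)
  then have "((\<lambda>t. S t $ j - S t $ i - v t j k / sqrt (\<omega> j k)) has_vector_derivative
      hamiltonian_deriv i t - hamiltonian_deriv k t) (at t within {0..1})"
    by simp
  then show ?case
  proof (rule has_vector_derivative_transform[OF t, rotated])
    fix s :: real assume "s \<in> {0..1}"
    then have "v s j k = sqrt (\<omega> j k) * (S s $ j - S s $ k)"
      using S step.hyps by (auto simp: induces_def)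
    then show "S s $ k - S s $ i = S s $ j - S s $ i - v s j k / sqrt (\<omega> j k)"
      using \<omega>_pos[OF step.hyps(2)] by simp
  qed
qed simp

lemma continuity_equation:
  assumes t: "t \<in> {0..1}" and \<rho>': "\<rho>' + graph_div E \<omega> (\<rho> t) (v t) = 0"
  shows "\<rho>' $ j + (\<Sum>l\<in>neighbours E j. \<omega> j l * (S t $ l - S t $ j) * edge_mean j l (\<rho> t)) = 0"
proof -
  have "(\<Sum>l\<in>neighbours E j. \<omega> j l * (S t $ l - S t $ j) * edge_mean j l (\<rho> t)) =
      - (\<Sum>l\<in>neighbours E j. sqrt (\<omega> j l) * v t j l * edge_mean j l (\<rho> t))"
    unfolding sum_negf[symmetric]
  proof (intro sum.cong refl)
    fix l assume "l \<in> neighbours E j"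
    then have e: "(j, l) \<in> E" by (simp add: neighbours_def)
    then have v: "v t j l = sqrt (\<omega> j l) * (S t $ j - S t $ l)"
      using S t by (auto simp: induces_def)
    have "sqrt (\<omega> j l) * v t j l = \<omega> j l * (S t $ j - S t $ l)"
      unfolding v mult.assoc[symmetric] using \<omega>_pos[OF e] by simp
    then have "\<omega> j l * (S t $ l - S t $ j) = - (sqrt (\<omega> j l) * v t j l)"
      by (simp only: minus_diff_eq flip: mult_minus_right)
    then show "\<omega> j l * (S t $ l - S t $ j) * edge_mean j l (\<rho> t) =
        - (sqrt (\<omega> j l) * v t j l * edge_mean j l (\<rho> t))"
      by (simp only: mult_minus_left)
  qed
  moreover have "\<rho>' $ j = (\<Sum>l\<in>neighbours E j. sqrt (\<omega> j l) * v t j l * edge_mean j l (\<rho> t))"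
    using arg_cong[OF \<rho>', of "\<lambda>x. x $ j"] by (simp add: graph_div_def)
  ultimately show ?thesis by simp
qed

text \<open>Each edge at \<open>j\<close> occurs in both orientations with equal squares, and its
  mean of \<open>axis j 1\<close> is 1/2. This turns the 1/4 of the flux energy into the 1/2 in
  front of the sum over neighbours.\<close>

lemma hamiltonian_deriv_eq:
  assumes t: "t \<in> {0..1}"
  shows "hamiltonian_deriv j t =
    1 / 2 * (\<Sum>l\<in>neighbours E j. \<omega> j l * (S t $ j - S t $ l)\<^sup>2 * partial_deriv j (edge_mean j l) (\<rho> t))
    + h\<^sup>2 / 8 * partial_deriv j (fisher_info E \<omega>) (\<rho> t) + V $ j + (\<Sum>l\<in>UNIV. W $ j $ l * \<rho> t $ l)"
proof -
  have v: "(v t j l)\<^sup>2 = \<omega> j l * (S t $ j - S t $ l)\<^sup>2" "(v t l j)\<^sup>2 = (v t j l)\<^sup>2" if "(j, l) \<in> E" for l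
  proof -
    have "v t j l = sqrt (\<omega> j l) * (S t $ j - S t $ l)" "v t l j = - v t j l"
      using that S t v_antisym[OF t] by (auto simp: induces_def vector_field_def)
    then show "(v t j l)\<^sup>2 = \<omega> j l * (S t $ j - S t $ l)\<^sup>2" "(v t l j)\<^sup>2 = (v t j l)\<^sup>2"
      using \<omega>_pos[OF that] by (simp_all add: power_mult_distrib)
  qed
  have "(\<Sum>(k, l)\<in>E. (v t k l)\<^sup>2 * edge_mean k l (axis j 1)) =
      (\<Sum>(k, l)\<in>E. (v t k l)\<^sup>2 / 2 * axis j 1 $ k) + (\<Sum>(k, l)\<in>E. (v t k l)\<^sup>2 / 2 * axis j 1 $ l)"
    unfolding sum.distrib[symmetric]
    by (intro sum.cong refl) (auto simp: edge_mean_def distrib_left)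
  also have "\<dots> = (\<Sum>l\<in>neighbours E j. (v t j l)\<^sup>2 / 2) + (\<Sum>l\<in>neighbours E j. (v t l j)\<^sup>2 / 2)"
    by (simp only: sum_edges_first sum_edges_second[OF E_sym])
  also have "\<dots> = 2 * (\<Sum>l\<in>neighbours E j. \<omega> j l * (S t $ j - S t $ l)\<^sup>2 * partial_deriv j (edge_mean j l) (\<rho> t))"
    unfolding sum.distrib[symmetric] sum_distrib_left
  proof (intro sum.cong refl)
    fix l assume "l \<in> neighbours E j"
    then have e: "(j, l) \<in> E" by (simp add: neighbours_def)
    have "edge_mean j l (axis j 1) = 1 / 2"
      using edge_neq[OF e] by (simp add: edge_mean_def axis_def)
    then show "(v t j l)\<^sup>2 / 2 + (v t l j)\<^sup>2 / 2 =
        2 * (\<omega> j l * (S t $ j - S t $ l)\<^sup>2 * partial_deriv j (edge_mean j l) (\<rho> t))"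
      using v[OF e] by (simp add: partial_deriv_edge_mean)
  qed
  finally show ?thesis
    by (simp add: hamiltonian_deriv_def energy_deriv_axis partial_deriv_fisher_info[OF \<rho>_pos[OF t]])
qed

end

end

section \<open>The gauge function and the resulting Hamiltonian system\<close>

theorem theorem3:
  fixes E :: "('n::finite \<times> 'n) set" and \<omega> :: "'n \<Rightarrow> 'n \<Rightarrow> real"
    and V :: "real ^ 'n" and W :: "real ^ 'n ^ 'n" and h :: real
    and \<rho>0 \<rho>1 :: "real ^ 'n"
    and v :: "real \<Rightarrow> 'n \<Rightarrow> 'n \<Rightarrow> real" and \<rho> :: "real \<Rightarrow> real ^ 'n"
  assumes "connected_weighted_graph E \<omega>"
    and "\<And>j l. W $ j $ l = W $ l $ j"
    and "h > 0"
    and "\<rho>0 \<in> pos_densities" and "\<rho>1 \<in> pos_densities"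
    and "critical_point E \<omega> h V W \<rho>0 \<rho>1 v \<rho>"
    and "smooth_field E v" and "smooth_unit \<rho>"
  shows "(\<exists>S. induces E \<omega> S v) \<and>
    (\<forall>S. induces E \<omega> S v \<longrightarrow>
      (\<exists>(C :: real \<Rightarrow> real) Sb \<rho>' Sb'.
        (\<forall>t j. Sb t $ j = S t $ j - C t) \<and>
        (\<forall>t\<in>{0..1}.
          (\<rho> has_vector_derivative \<rho>' t) (at t within {0..1}) \<and>
          (Sb has_vector_derivative Sb' t) (at t within {0..1}) \<and>
          (\<forall>j.
            \<rho>' t $ j + (\<Sum>l\<in>neighbours E j. \<omega> j l * (Sb t $ l - Sb t $ j) * edge_mean j l (\<rho> t)) = 0 \<and>
            Sb' t $ j
              + 1 / 2 * (\<Sum>l\<in>neighbours E j. \<omega> j l * (Sb t $ j - Sb t $ l)\<^sup>2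
                           * partial_deriv j (edge_mean j l) (\<rho> t))
              + h\<^sup>2 / 8 * partial_deriv j (fisher_info E \<omega>) (\<rho> t)
              + V $ j + (\<Sum>l\<in>UNIV. W $ j $ l * \<rho> t $ l) = 0))))"
proof (intro conjI allI impI)
  interpret critical_path E \<omega> V W h \<rho>0 \<rho>1 v \<rho>
    using assms by unfold_locales
  show "\<exists>S. induces E \<omega> S v" by (rule potential_exists)
  fix S assume S: "induces E \<omega> S v"
  obtain \<rho>' where \<rho>':
    "\<And>t. t \<in> {0..1} \<Longrightarrow> (\<rho> has_vector_derivative \<rho>' t) (at t within {0..1})"
    "\<And>t. t \<in> {0..1} \<Longrightarrow> \<rho>' t + graph_div E \<omega> (\<rho> t) (v t) = 0"
    using transports_\<rho> unfolding transports_def by blast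
  obtain i :: 'n where "i \<in> UNIV" by blast
  \<comment> \<open>Normalization at a reference vertex: subtracting \<open>C\<close> replaces the
    possibly irregular S_i by minus the integral of \<open>hamiltonian_deriv i\<close>, which
    satisfies the equation at \<open>i\<close>. The other vertices follow from the differences to
    S_i.\<close>
  define C where "C t = S t $ i + integral {0..t} (hamiltonian_deriv i)" for t
  define Sb :: "real \<Rightarrow> real ^ 'n" where "Sb t = (\<chi> j. S t $ j - C t)" for t
  define Sb' :: "real \<Rightarrow> real ^ 'n" where "Sb' t = (\<chi> j. - hamiltonian_deriv j t)" for t
  have Sb_deriv: "(Sb has_vector_derivative Sb' t) (at t within {0..1})" if t: "t \<in> {0..1}" for t
  proof -
    have "((\<lambda>t. (S t $ j - S t $ i) - integral {0..t} (hamiltonian_deriv i)) has_vector_derivative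
        (hamiltonian_deriv i t - hamiltonian_deriv j t) - hamiltonian_deriv i t) (at t within {0..1})" for j
      by (intro has_vector_derivative_diff potential_difference_deriv S t
          integral_has_vector_derivative smooth_unit_continuous smooth_hamiltonian_deriv)
    then have "((\<lambda>t. S t $ j - C t) has_vector_derivative - hamiltonian_deriv j t) (at t within {0..1})" for j
      by (simp add: C_def diff_diff_eq)
    then show ?thesis
      unfolding Sb_def Sb'_def by (rule has_vector_derivative_vec_lambda)
  qed
  show "\<exists>C Sb \<rho>' Sb'. (\<forall>t j. Sb t $ j = S t $ j - C t) \<and>
      (\<forall>t\<in>{0..1}. (\<rho> has_vector_derivative \<rho>' t) (at t within {0..1}) \<and>
        (Sb has_vector_derivative Sb' t) (at t within {0..1}) \<and>
        (\<forall>j. \<rho>' t $ j + (\<Sum>l\<in>neighbours E j. \<omega> j l * (Sb t $ l - Sb t $ j) * edge_mean j l (\<rho> t)) = 0 \<and>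
          Sb' t $ j
            + 1 / 2 * (\<Sum>l\<in>neighbours E j. \<omega> j l * (Sb t $ j - Sb t $ l)\<^sup>2
                         * partial_deriv j (edge_mean j l) (\<rho> t))
            + h\<^sup>2 / 8 * partial_deriv j (fisher_info E \<omega>) (\<rho> t)
            + V $ j + (\<Sum>l\<in>UNIV. W $ j $ l * \<rho> t $ l) = 0))"
  proof (rule exI[of _ C], rule exI[of _ Sb], rule exI[of _ \<rho>'], rule exI[of _ Sb'],
      intro conjI allI ballI \<rho>'(1) Sb_deriv)
    show "Sb t $ j = S t $ j - C t" for t j by (simp add: Sb_def)
    fix t :: real and j assume t: "t \<in> {0..1}"
    \<comment> \<open>The remaining terms contain the potential only through differences, so the
      gauge drops out and the equations for \<open>S\<close> carry over.\<close>
    have diff: "Sb t $ k - Sb t $ l = S t $ k - S t $ l" for k l by (simp add: Sb_def)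
    show "\<rho>' t $ j + (\<Sum>l\<in>neighbours E j. \<omega> j l * (Sb t $ l - Sb t $ j) * edge_mean j l (\<rho> t)) = 0"
      unfolding diff by (rule continuity_equation[OF S t \<rho>'(2)[OF t]])
    show "Sb' t $ j
            + 1 / 2 * (\<Sum>l\<in>neighbours E j. \<omega> j l * (Sb t $ j - Sb t $ l)\<^sup>2
                         * partial_deriv j (edge_mean j l) (\<rho> t))
            + h\<^sup>2 / 8 * partial_deriv j (fisher_info E \<omega>) (\<rho> t)
            + V $ j + (\<Sum>l\<in>UNIV. W $ j $ l * \<rho> t $ l) = 0"
      unfolding diff using hamiltonian_deriv_eq[OF S t, of j] by (simp add: Sb'_def)
  qed
qed

end
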